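(* Let $H=\bigoplus_{i=1}^m H_i$ be the direct sum of separable real Hilbert spaces $H_1,\dots,H_m$, let $f\colon H\to\mathbb{R}$ be convex and differentiable, let $h_i\colon H_i\to\,]-\infty,+\infty]$ be proper, convex and lower semicontinuous for $i=1,\dots,m$, and set $h(x)=\sum_{i=1}^m h_i(x_i)$ and $F=f+h$. Let $\varepsilon=(\varepsilon_1,\dots,\varepsilon_m)$ be a $\{0,1\}^m$-valued random variable with $p_i:=\mathsf{P}(\varepsilon_i=1)>0$ for every $i$ and $\mathsf{P}(\varepsilon=(0,\dots,0))=0$, and let $(\varepsilon^n)_{n\in\mathbb{N}}$ be a sequence of independent copies of $\varepsilon$. Let $(\nu_i)_{1\le i\le m}\in\,]0,+\infty[^m$ be such that $$(\forall x,v\in H)\quad \mathsf{E}[f(x+\varepsilon\odot v)]\le f(x)+\mathsf{E}[\langle\nabla f(x),\varepsilon\odot v\rangle]+\frac12\sum_{i=1}^m p_i\nu_i\|v_i\|^2 .$$ Let $0<\gamma_i<2/\nu_i$ for every $i\in\{1,\dots,m\}$, let $x^0\in\operatorname{dom}h$ be deterministic, and let $(x^n)_{n\in\mathbb{N}}$ be the sequence of $H$-valued random variables defined by $$x_i^{n+1}=x_i^n+\varepsilon_i^n\big(\mathrm{prox}_{\gamma_i h_i}(x_i^n-\gamma_i\nabla_i f(x^n))-x_i^n\big),\qquad i=1,\dots,m,\ n\in\mathbb{N}.$$ Set $\delta=\max_{1\le i\le m}\gamma_i\nu_i$, $p_{\min}=\min_{1\le i\le m}p_i$, $F_*=\inf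 F$ and $S_*=\operatorname{argmin}F$. Then the following hold. (i) $\mathsf{E}[F(x^n)]\to F_*$. (ii) Suppose that $S_*\ne\varnothing$. Then $\mathsf{E}[F(x^n)]-F_*=o(1/n)$ and, for every integer $n\ge1$, $$\mathsf{E}[F(x^n)]-F_*\le\left[\frac{\mathrm{dist}_W^2(x^0,S_* )}{2}+\Big(\frac{\max\{1,(2-\delta)^{-1}\}}{p_{\min}}-1\Big)(F(x^0)-F_* )\right]\frac1n .$$ Moreover, there exists a random variable $x_*$ taking values in $S_*$ such that $x^n\rightharpoonup x_*$ (weak convergence in $H$) $\mathsf{P}$-almost surely.
   Context: $H=\bigoplus_i H_i$ carries the inner product $\langle x,y\rangle=\sum_{i=1}^m\langle x_i,y_i\rangle$; $\nabla_i f(x)\in H_i$ is the $i$-th component of $\nabla f(x)$. For $v\in H$ and $\epsilon\in\{0,1\}^m$, $\epsilon\odot v=(\epsilon_iv_i)_{1\le i\le m}\in H$. For a proper convex lower semicontinuous function $\varphi$ on a Hilbert space, $\mathrm{prox}_\varphi(x)=\operatorname{argmin}_z\ \varphi(z)+\frac12\|x-z\|^2$. The weighted norm is $\|x\|_W^2=\sum_{i=1}^m\frac{1}{\gamma_ip_i}\|x_i\|^2$ and $\mathrm{dist}_W(x,S)=\inf_{z\in S}\|x-z\|_W$. *)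

theory Defs
  imports "HOL-Probability.Probability"
begin

text \<open>
  The summands of the direct sum may be different Hilbert spaces. They are modelled as closed
  subspaces \<open>V i\<close> of an arbitrary ambient separable Hilbert space \<open>'a\<close>; every finite family of
  separable Hilbert spaces is of this form up to isometry. The inner product of the type
  \<open>'a ^ 'm\<close> is the sum of the inner products of the components. Functions on a summand or on the
  direct sum are relevant only on the corresponding set.
\<close>

definition direct_sum :: "('m::finite \<Rightarrow> 'a set) \<Rightarrow> ('a ^ 'm) set" where
  "direct_sum V = {x. \<forall>i. x $ i \<in> V i}"

definition mask :: "('m::finite \<Rightarrow> bool) \<Rightarrow> 'a::real_vector ^ 'm \<Rightarrow> 'a ^ 'm" (infixr "\<odot>" 75) where
  "e \<odot> v = (\<chi> i. of_bool (e i) *\<^sub>R (v $ i))"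

text \<open>The gradient of a function on a closed subspace \<open>S\<close>; it is an element of \<open>S\<close>.\<close>

definition gradient_on :: "'b::real_inner set \<Rightarrow> ('b \<Rightarrow> real) \<Rightarrow> 'b \<Rightarrow> 'b" where
  "gradient_on S f x = (THE g. g \<in> S \<and> (f has_derivative (\<lambda>v. g \<bullet> v)) (at x within S))"

definition proper_on :: "'b set \<Rightarrow> ('b \<Rightarrow> ereal) \<Rightarrow> bool" where
  "proper_on S \<phi> \<longleftrightarrow> (\<forall>x\<in>S. \<phi> x \<noteq> -\<infinity>) \<and> (\<exists>x\<in>S. \<phi> x \<noteq> \<infinity>)"

text \<open>Note that \<open>0 * \<infinity> = 0\<close> in the extended reals, so the cases \<open>u = 0\<close> and \<open>v = 0\<close> are trivial.\<close>

definition ereal_convex_on :: "'b::real_vector set \<Rightarrow> ('b \<Rightarrow> ereal) \<Rightarrow> bool" where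
  "ereal_convex_on S \<phi> \<longleftrightarrow> convex S \<and>
    (\<forall>x\<in>S. \<forall>y\<in>S. \<forall>u\<ge>0. \<forall>v\<ge>0. u + v = 1 \<longrightarrow>
      \<phi> (u *\<^sub>R x + v *\<^sub>R y) \<le> ereal u * \<phi> x + ereal v * \<phi> y)"

definition lsc_on :: "'b::topological_space set \<Rightarrow> ('b \<Rightarrow> ereal) \<Rightarrow> bool" where
  "lsc_on S \<phi> \<longleftrightarrow> (\<forall>x\<in>S. \<phi> x \<le> Liminf (at x within S) \<phi>)"

definition prox_on :: "'b::real_inner set \<Rightarrow> ('b \<Rightarrow> ereal) \<Rightarrow> 'b \<Rightarrow> 'b" where
  "prox_on S \<phi> x = arg_min_on (\<lambda>z. \<phi> z + ereal (1 / 2 * (norm (x - z))\<^sup>2)) S"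

definition argmin_set :: "'b set \<Rightarrow> ('b \<Rightarrow> ereal) \<Rightarrow> 'b set" where
  "argmin_set S F = {x. is_arg_min F (\<lambda>z. z \<in> S) x}"

definition separable_sum :: "('m::finite \<Rightarrow> 'a \<Rightarrow> ereal) \<Rightarrow> 'a ^ 'm \<Rightarrow> ereal" where
  "separable_sum h x = (\<Sum>i\<in>UNIV. h i (x $ i))"

definition norm_W :: "('m::finite \<Rightarrow> real) \<Rightarrow> ('m \<Rightarrow> real) \<Rightarrow> 'a::real_normed_vector ^ 'm \<Rightarrow> real" where
  "norm_W \<gamma> p x = sqrt (\<Sum>i\<in>UNIV. 1 / (\<gamma> i * p i) * (norm (x $ i))\<^sup>2)"

definition dist_W ::
  "('m::finite \<Rightarrow> real) \<Rightarrow> ('m \<Rightarrow> real) \<Rightarrow> 'a::real_normed_vector ^ 'm \<Rightarrow> ('a ^ 'm) set \<Rightarrow> real" where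
  "dist_W \<gamma> p x S = (INF z\<in>S. norm_W \<gamma> p (x - z))"

text \<open>
  Expectation of an extended-real-valued random variable, as the difference of the integrals of
  its positive and negative parts (\<open>e2ennreal\<close> maps negative numbers to \<open>0\<close>).
\<close>

definition ereal_expectation :: "'w measure \<Rightarrow> ('w \<Rightarrow> ereal) \<Rightarrow> ereal" where
  "ereal_expectation M X =
    enn2ereal (\<integral>\<^sup>+\<omega>. e2ennreal (X \<omega>) \<partial>M) - enn2ereal (\<integral>\<^sup>+\<omega>. e2ennreal (- X \<omega>) \<partial>M)"

definition weakly_tendsto_on :: "'b::real_inner set \<Rightarrow> (nat \<Rightarrow> 'b) \<Rightarrow> 'b \<Rightarrow> bool" where
  "weakly_tendsto_on S X l \<longleftrightarrow> (\<forall>y\<in>S. (\<lambda>n. X n \<bullet> y) \<longlonglongrightarrow> l \<bullet> y)"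

end

theory Submission
  imports Defs "HOL-Complex_Analysis.Great_Picard"
begin

text \<open>
  Write \<open>x\<^sup>+\<close> for the next iterate, \<open>\<parallel>\<cdot>\<parallel>\<close> for the weighted norm and
  \<open>c = max 1 (1 / (2 - \<delta>)) / p_min\<close>. The variational inequality of the proximity operator, the
  smoothness assumption and the gradient inequality of \<open>f\<close> yield, for every \<open>z\<close> in the domain of \<open>F\<close>,
  \<open>E \<parallel>x\<^sup>+ - z\<parallel>\<^sup>2 / 2 \<le> \<parallel>x - z\<parallel>\<^sup>2 / 2 - (F x - F z) + c (F x - E F x\<^sup>+)\<close>.
  Since \<open>E F (x\<^sup>n)\<close> decreases, summation over \<open>n\<close> gives the limit of \<open>E F (x\<^sup>n)\<close>, the explicit rate
  and, for a minimizer \<open>z\<close>, the summability of \<open>E F (x\<^sup>n) - F z\<close>, hence the rate \<open>o(1/n)\<close> and the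
  almost sure convergence \<open>F (x\<^sup>n) \<rightarrow> F z\<close>. Moreover \<open>\<parallel>x\<^sup>n - z\<parallel>\<^sup>2 / 2 + c (F (x\<^sup>n) - F z)\<close> is a
  nonnegative supermartingale, so \<open>\<parallel>x\<^sup>n - z\<parallel>\<close> converges almost surely by Doob's theorem,
  simultaneously for all \<open>z\<close> in a countable dense set of minimizers. As \<open>F\<close> is weakly lower
  semicontinuous, Opial's lemma applies.

  Since the masks take finitely many values, every iterate is a simple function of the past masks,
  so measurability and integrability are automatic and conditional expectations reduce to
  independence of the next mask from the past.
\<close>

section \<open>Lower semicontinuous convex functions\<close>

lemma lsc_on_iff_openin:
  "lsc_on S \<phi> \<longleftrightarrow> (\<forall>b. openin (top_of_set S) {x \<in> S. b < \<phi> x})"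
proof
  assume lsc: "lsc_on S \<phi>"
  show "\<forall>b. openin (top_of_set S) {x \<in> S. b < \<phi> x}"
  proof
    fix b
    show "openin (top_of_set S) {x \<in> S. b < \<phi> x}"
    proof (subst openin_subopen, intro ballI)
      fix x assume x_in_superlevel: "x \<in> {x \<in> S. b < \<phi> x}"
      then have "\<forall>\<^sub>F y in at x within S. b < \<phi> y"
        using lsc by (auto simp: lsc_on_def le_Liminf_iff)
      then obtain U where "open U" "x \<in> U" "\<And>y. y \<in> U \<Longrightarrow> y \<noteq> x \<Longrightarrow> y \<in> S \<Longrightarrow> b < \<phi> y"
        unfolding eventually_at_topological by blast
      then show "\<exists>T. openin (top_of_set S) T \<and> x \<in> T \<and> T \<subseteq> {x \<in> S. b < \<phi> x}"
        using x_in_superlevel by (intro exI[of _ "S \<inter> U"]) auto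
    qed
  qed
next
  assume superlevel: "\<forall>b. openin (top_of_set S) {x \<in> S. b < \<phi> x}"
  show "lsc_on S \<phi>"
    unfolding lsc_on_def le_Liminf_iff
  proof (intro ballI allI impI)
    fix x b assume "x \<in> S" "b < \<phi> x"
    moreover obtain U where "open U" "{x \<in> S. b < \<phi> x} = S \<inter> U"
      using superlevel openin_open by metis
    ultimately show "\<forall>\<^sub>F y in at x within S. b < \<phi> y"
      unfolding eventually_at_topological by blast
  qed
qed

lemma lsc_on_less_near:
  fixes \<phi> :: "'b::metric_space \<Rightarrow> ereal"
  assumes "lsc_on S \<phi>" "x \<in> S" "b < \<phi> x"
  obtains d where "d > 0" "\<And>y. y \<in> S \<Longrightarrow> dist y x < d \<Longrightarrow> b < \<phi> y"
proof -
  have "\<forall>\<^sub>F y in at x within S. b < \<phi> y"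
    using assms by (simp add: lsc_on_def le_Liminf_iff)
  then obtain d where near: "d > 0" "\<And>y. y \<in> S \<Longrightarrow> y \<noteq> x \<Longrightarrow> dist y x < d \<Longrightarrow> b < \<phi> y"
    unfolding eventually_at by blast
  have "b < \<phi> y" if "y \<in> S" "dist y x < d" for y
    using near(2)[OF that(1) _ that(2)] assms(3) by (cases "y = x") auto
  with near(1) show thesis
    by (rule that)
qed

lemma closed_sublevel:
  assumes "closed S" "lsc_on S \<phi>"
  shows "closed {x \<in> S. \<phi> x \<le> b}"
proof -
  have "closedin (top_of_set S) (S - {x \<in> S. b < \<phi> x})"
    using assms(2) by (auto simp: lsc_on_iff_openin intro: closedin_diff)
  moreover have "S - {x \<in> S. b < \<phi> x} = {x \<in> S. \<phi> x \<le> b}"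
    by auto
  ultimately show ?thesis
    using assms(1) closedin_closed_trans by metis
qed

lemma lsc_on_continuous_on:
  assumes "continuous_on S g"
  shows "lsc_on S (\<lambda>x. ereal (g x))"
proof -
  have "continuous_on S (\<lambda>x. ereal (g x))"
    using assms by (intro continuous_intros)
  then have "openin (top_of_set S) (S \<inter> (\<lambda>x. ereal (g x)) -` {b<..})" for b
    by (intro continuous_openin_preimage_gen) auto
  then show ?thesis
    by (simp add: lsc_on_iff_openin vimage_def Int_def)
qed

lemma lsc_on_compose:
  assumes "lsc_on T \<phi>" "continuous_on S g" "g ` S \<subseteq> T"
  shows "lsc_on S (\<lambda>x. \<phi> (g x))"
  unfolding lsc_on_iff_openin
proof
  fix b
  have "openin (top_of_set S) (S \<inter> g -` {y \<in> T. b < \<phi> y})"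
    using assms by (intro continuous_openin_preimage[where T = T]) (auto simp: lsc_on_iff_openin)
  moreover have "S \<inter> g -` {y \<in> T. b < \<phi> y} = {x \<in> S. b < \<phi> (g x)}"
    using assms(3) by auto
  ultimately show "openin (top_of_set S) {x \<in> S. b < \<phi> (g x)}"
    by simp
qed

lemma lsc_on_cmult:
  assumes "lsc_on S \<phi>" "c > 0"
  shows "lsc_on S (\<lambda>x. ereal c * \<phi> x)"
proof -
  have "b < ereal c * y \<longleftrightarrow> b / ereal c < y" for b y
    using \<open>c > 0\<close> by (simp add: ereal_divide_less_pos mult.commute)
  then show ?thesis
    using assms(1) by (simp add: lsc_on_iff_openin)
qed

lemma ereal_less_addE:
  fixes a b c :: ereal
  assumes "c < a + b" "a \<noteq> -\<infinity>" "b \<noteq> -\<infinity>"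
  obtains r s where "r < a" "s < b" "c \<le> r + s"
proof (cases a)
  case (real a')
  then obtain d where d_between: "c < ereal d" "ereal d - a < b"
    using assms(1) ereal_dense2[of c "a + b"] by (cases b) auto
  then obtain s where s_between: "ereal d - a < ereal s" "ereal s < b"
    using ereal_dense2 by blast
  have "ereal (d - s) < a"
    using s_between(1) real by simp
  then show thesis
    using that[of "ereal (d - s)" "ereal s"] s_between(2) d_between(1) by simp
next
  case PInf
  obtain s where s_between: "ereal s < b"
    using assms(3) ereal_dense2[of "-\<infinity>" b] by auto
  have "c - ereal s < a"
    using assms(1) PInf by (cases c) auto
  then show thesis
    using that[of "c - ereal s" "ereal s"] s_between by (cases c) auto
qed (use assms in simp)

lemma lsc_on_add:
  assumes "lsc_on S \<phi>" "lsc_on S \<psi>"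
    and "\<And>x. x \<in> S \<Longrightarrow> \<phi> x \<noteq> -\<infinity>" "\<And>x. x \<in> S \<Longrightarrow> \<psi> x \<noteq> -\<infinity>"
  shows "lsc_on S (\<lambda>x. \<phi> x + \<psi> x)"
  unfolding lsc_on_def le_Liminf_iff
proof (intro ballI allI impI)
  fix x b assume "x \<in> S" "b < \<phi> x + \<psi> x"
  then obtain r s where "r < \<phi> x" "s < \<psi> x" and b_le: "b \<le> r + s"
    using assms(3,4) ereal_less_addE by metis
  then have "\<forall>\<^sub>F y in at x within S. r < \<phi> y" "\<forall>\<^sub>F y in at x within S. s < \<psi> y"
    using assms(1,2) \<open>x \<in> S\<close> by (auto simp: lsc_on_def le_Liminf_iff)
  then show "\<forall>\<^sub>F y in at x within S. b < \<phi> y + \<psi> y"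
    by eventually_elim (rule le_less_trans[OF b_le ereal_add_strict_mono2])
qed

lemma sum_ereal_not_MInfty:
  fixes a :: "'i \<Rightarrow> ereal"
  assumes "\<And>i. i \<in> I \<Longrightarrow> a i \<noteq> -\<infinity>"
  shows "(\<Sum>i\<in>I. a i) \<noteq> -\<infinity>"
  using assms by (induction I rule: infinite_finite_induct) auto

lemma lsc_on_sum:
  assumes "finite I" "\<And>i. i \<in> I \<Longrightarrow> lsc_on S (\<phi> i)" "\<And>i x. i \<in> I \<Longrightarrow> x \<in> S \<Longrightarrow> \<phi> i x \<noteq> -\<infinity>"
  shows "lsc_on S (\<lambda>x. \<Sum>i\<in>I. \<phi> i x)"
  using assms
proof (induction I rule: finite_induct)
  case empty
  then show ?case
    using lsc_on_continuous_on[of S "\<lambda>_. 0"] by (simp add: zero_ereal_def)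
next
  case (insert i I)
  then have "lsc_on S (\<lambda>x. \<phi> i x + (\<Sum>i\<in>I. \<phi> i x))"
    by (intro lsc_on_add sum_ereal_not_MInfty) auto
  with insert.hyps show ?case
    by simp
qed

lemma ereal_convex_onD:
  assumes "ereal_convex_on S \<phi>" "x \<in> S" "y \<in> S" "u \<ge> 0" "v \<ge> 0" "u + v = 1"
    "\<phi> x \<le> ereal a" "\<phi> y \<le> ereal b"
  shows "\<phi> (u *\<^sub>R x + v *\<^sub>R y) \<le> ereal (u * a + v * b)"
proof -
  have "\<phi> (u *\<^sub>R x + v *\<^sub>R y) \<le> ereal u * \<phi> x + ereal v * \<phi> y"
    using assms unfolding ereal_convex_on_def by blast
  also have "\<dots> \<le> ereal u * ereal a + ereal v * ereal b"
    using assms by (intro add_mono ereal_mult_left_mono) auto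
  finally show ?thesis
    by simp
qed

lemma ereal_convex_on_convex_combination_in:
  assumes "ereal_convex_on S \<phi>" "x \<in> S" "y \<in> S" "u \<ge> 0" "v \<ge> 0" "u + v = 1"
  shows "u *\<^sub>R x + v *\<^sub>R y \<in> S"
  using assms by (auto simp: ereal_convex_on_def intro: convexD)

lemma convex_sublevel:
  assumes "ereal_convex_on S \<phi>"
  shows "convex {x \<in> S. \<phi> x \<le> b}"
proof (rule convexI)
  fix x y and u v :: real
  assume in_sublevel: "x \<in> {x \<in> S. \<phi> x \<le> b}" "y \<in> {x \<in> S. \<phi> x \<le> b}"
    and weights: "0 \<le> u" "0 \<le> v" "u + v = 1"
  have "\<phi> (u *\<^sub>R x + v *\<^sub>R y) \<le> ereal u * \<phi> x + ereal v * \<phi> y"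
    using assms in_sublevel weights by (auto simp: ereal_convex_on_def)
  also have "\<dots> \<le> ereal u * b + ereal v * b"
    using in_sublevel weights by (intro add_mono ereal_mult_left_mono) auto
  also have "\<dots> = b"
    using weights by (simp flip: ereal_left_distrib)
  finally show "u *\<^sub>R x + v *\<^sub>R y \<in> {x \<in> S. \<phi> x \<le> b}"
    using ereal_convex_on_convex_combination_in[OF assms] in_sublevel weights by auto
qed

lemma ereal_convex_on_real:
  assumes "convex_on S g"
  shows "ereal_convex_on S (\<lambda>x. ereal (g x))"
  using assms by (auto simp: ereal_convex_on_def convex_on_def)

lemma ereal_convex_on_compose_linear:
  assumes "ereal_convex_on T \<phi>" "linear g" "convex S" "g ` S \<subseteq> T"
  shows "ereal_convex_on S (\<lambda>x. \<phi> (g x))"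
  using assms by (auto simp: ereal_convex_on_def linear_add linear_scale image_subset_iff)

lemma ereal_convex_on_cmult:
  assumes "ereal_convex_on S \<phi>" "c \<ge> 0"
  shows "ereal_convex_on S (\<lambda>x. ereal c * \<phi> x)"
  unfolding ereal_convex_on_def
proof (intro conjI ballI allI impI)
  show "convex S"
    using assms(1) by (simp add: ereal_convex_on_def)
  fix x y u v assume combination: "x \<in> S" "y \<in> S" "(u::real) \<ge> 0" "(v::real) \<ge> 0" "u + v = 1"
  have "ereal c * \<phi> (u *\<^sub>R x + v *\<^sub>R y) \<le> ereal c * (ereal u * \<phi> x + ereal v * \<phi> y)"
    using assms combination by (intro ereal_mult_left_mono) (auto simp: ereal_convex_on_def)
  also have "\<dots> = ereal u * (ereal c * \<phi> x) + ereal v * (ereal c * \<phi> y)"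
    using assms(2) by (simp add: ereal_pos_distrib mult.left_commute)
  finally show "ereal c * \<phi> (u *\<^sub>R x + v *\<^sub>R y) \<le> \<dots>" .
qed

lemma ereal_convex_on_add:
  assumes "ereal_convex_on S \<phi>" "ereal_convex_on S \<psi>"
  shows "ereal_convex_on S (\<lambda>x. \<phi> x + \<psi> x)"
  unfolding ereal_convex_on_def
proof (intro conjI ballI allI impI)
  show "convex S"
    using assms(1) by (simp add: ereal_convex_on_def)
  fix x y u v assume combination: "x \<in> S" "y \<in> S" "(u::real) \<ge> 0" "(v::real) \<ge> 0" "u + v = 1"
  have "\<phi> (u *\<^sub>R x + v *\<^sub>R y) + \<psi> (u *\<^sub>R x + v *\<^sub>R y)
      \<le> (ereal u * \<phi> x + ereal v * \<phi> y) + (ereal u * \<psi> x + ereal v * \<psi> y)"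
    using assms combination by (intro add_mono) (auto simp: ereal_convex_on_def)
  also have "\<dots> = ereal u * (\<phi> x + \<psi> x) + ereal v * (\<phi> y + \<psi> y)"
    using combination by (simp add: ereal_pos_distrib ac_simps)
  finally show "\<phi> (u *\<^sub>R x + v *\<^sub>R y) + \<psi> (u *\<^sub>R x + v *\<^sub>R y) \<le> \<dots>" .
qed

lemma ereal_convex_on_sum:
  assumes "finite I" "convex S" "\<And>i. i \<in> I \<Longrightarrow> ereal_convex_on S (\<phi> i)"
  shows "ereal_convex_on S (\<lambda>x. \<Sum>i\<in>I. \<phi> i x)"
  using assms
proof (induction I rule: finite_induct)
  case empty
  then show ?case
    by (simp add: ereal_convex_on_def)
next
  case (insert i I)
  then show ?case
    by (simp add: ereal_convex_on_add)
qed

definition closed_proper_convex_on :: "'b::real_normed_vector set \<Rightarrow> ('b \<Rightarrow> ereal) \<Rightarrow> bool" where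
  "closed_proper_convex_on S \<phi> \<longleftrightarrow>
    closed S \<and> proper_on S \<phi> \<and> ereal_convex_on S \<phi> \<and> lsc_on S \<phi>"

lemma closed_proper_convex_on_cmult:
  assumes "closed_proper_convex_on S \<phi>" "c > 0"
  shows "closed_proper_convex_on S (\<lambda>x. ereal c * \<phi> x)"
proof -
  have "proper_on S (\<lambda>x. ereal c * \<phi> x)"
    using assms by (auto simp: closed_proper_convex_on_def proper_on_def ereal_mult_eq_MInfty
        ereal_mult_eq_PInfty)
  then show ?thesis
    using assms by (simp add: closed_proper_convex_on_def ereal_convex_on_cmult lsc_on_cmult)
qed

lemma closed_proper_convex_on_real:
  assumes "closed S" "S \<noteq> {}" "convex_on S g" "continuous_on S g"
  shows "closed_proper_convex_on S (\<lambda>x. ereal (g x))"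
  using assms by (auto simp: closed_proper_convex_on_def proper_on_def ereal_convex_on_real
      lsc_on_continuous_on)

section \<open>Proximity operators\<close>

text \<open>A minorant that is linear in the norm suffices for the existence of proximal points and needs
  no separation theorem: lower semicontinuity bounds \<open>\<phi>\<close> from below near \<open>x\<close>, and convexity
  propagates the bound along rays.\<close>

lemma ereal_convex_on_ge_along_ray:
  fixes \<phi> :: "'b::real_normed_vector \<Rightarrow> ereal"
  assumes cvx: "ereal_convex_on S \<phi>" and center: "x \<in> S" "\<phi> x = ereal a"
    and near: "\<And>y. y \<in> S \<Longrightarrow> norm (y - x) \<le> r \<Longrightarrow> ereal (a - 1) < \<phi> y" and "r > 0"
    and endpoint: "z \<in> S" "\<phi> z \<le> ereal b"
  shows "a - 1 - norm (z - x) / r \<le> b"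
proof (cases "norm (z - x) \<le> r")
  case True
  have "ereal (a - 1) < ereal b"
    using near[OF endpoint(1) True] endpoint(2) by (rule less_le_trans)
  moreover have "norm (z - x) / r \<ge> 0"
    using \<open>r > 0\<close> by simp
  ultimately show ?thesis
    unfolding less_ereal.simps by linarith
next
  case False
  define t where "t = r / norm (z - x)"
  have t_bounds: "0 < t" "t < 1"
    using False \<open>r > 0\<close> by (auto simp: t_def divide_simps)
  define y where "y = (1 - t) *\<^sub>R x + t *\<^sub>R z"
  have "y - x = t *\<^sub>R (z - x)"
    by (simp add: y_def algebra_simps)
  then have "norm (y - x) = r"
    using False \<open>r > 0\<close> by (cases "z = x") (auto simp: t_def)
  then have "ereal (a - 1) < \<phi> y"
    using ereal_convex_on_convex_combination_in[OF cvx center(1) endpoint(1), of "1 - t" t] t_bounds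
    by (intro near) (auto simp: y_def)
  also have "\<phi> y \<le> ereal ((1 - t) * a + t * b)"
    unfolding y_def using t_bounds center endpoint by (intro ereal_convex_onD[OF cvx]) auto
  finally have "t * (a - b) < 1"
    by (simp add: algebra_simps)
  then have "a - b < 1 / t"
    using t_bounds by (simp add: field_simps)
  then show ?thesis
    by (simp add: t_def)
qed

lemma ereal_convex_lsc_minorant:
  fixes \<phi> :: "'b::real_normed_vector \<Rightarrow> ereal"
  assumes cvx: "ereal_convex_on S \<phi>" and lsc: "lsc_on S \<phi>" and center: "x \<in> S" "\<phi> x = ereal a"
  obtains r where "r > 0" "\<And>z. z \<in> S \<Longrightarrow> ereal (a - 1 - norm (z - x) / r) \<le> \<phi> z"
proof -
  obtain d where "d > 0" and near: "\<And>y. y \<in> S \<Longrightarrow> dist y x < d \<Longrightarrow> ereal (a - 1) < \<phi> y"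
    using lsc_on_less_near[OF lsc center(1), of "ereal (a - 1)"] center(2) by auto
  have "ereal (a - 1 - norm (z - x) / (d / 2)) \<le> \<phi> z" if "z \<in> S" for z
  proof (rule ereal_le_real)
    fix b assume "\<phi> z \<le> ereal b"
    then have "a - 1 - norm (z - x) / (d / 2) \<le> b"
      using \<open>d > 0\<close> that
      by (intro ereal_convex_on_ge_along_ray[OF cvx center near]) (auto simp: dist_norm)
    then show "ereal (a - 1 - norm (z - x) / (d / 2)) \<le> ereal b"
      by simp
  qed
  then show thesis
    using that[of "d / 2"] \<open>d > 0\<close> by simp
qed

lemma ereal_le_if_le_add_inverse_Suc:
  assumes "\<And>n. c \<le> ereal (\<mu> + 1 / real (Suc n))"
  shows "c \<le> ereal \<mu>"
proof (rule ereal_le_epsilon2)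
  fix e :: real assume "e > 0"
  then obtain n where "1 / real (Suc n) < e"
    using nat_approx_posE by blast
  then have "ereal (\<mu> + 1 / real (Suc n)) \<le> ereal \<mu> + ereal e"
    by simp
  with assms show "c \<le> ereal \<mu> + ereal e"
    by (rule order_trans)
qed

lemma lsc_attains_Inf_if_sublevels_shrink:
  fixes J :: "'b::complete_space \<Rightarrow> ereal"
  assumes closed_lsc: "closed S" "lsc_on S J" and Inf: "(INF z\<in>S. J z) = ereal \<mu>"
    and shrink: "\<And>e. e > 0 \<Longrightarrow> \<exists>n. \<forall>a\<in>S. \<forall>b\<in>S.
      J a \<le> ereal (\<mu> + 1 / real (Suc n)) \<longrightarrow> J b \<le> ereal (\<mu> + 1 / real (Suc n)) \<longrightarrow> dist a b < e"
  obtains u where "u \<in> S" "J u = ereal \<mu>"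
proof -
  define L where "L n = {z \<in> S. J z \<le> ereal (\<mu> + 1 / real (Suc n))}" for n
  obtain u where u_in_sublevels: "\<And>n. u \<in> L n"
  proof (rule decreasing_closed_nest[of L])
    show "closed (L n)" for n
      unfolding L_def by (rule closed_sublevel[OF closed_lsc])
    show "L n \<noteq> {}" for n
    proof -
      have "(INF z\<in>S. J z) < ereal (\<mu> + 1 / real (Suc n))"
        by (simp add: Inf)
      then show ?thesis
        unfolding INF_less_iff L_def by (auto intro: less_imp_le)
    qed
    show "L n \<subseteq> L k" if "k \<le> n" for k n
    proof -
      have "ereal (\<mu> + 1 / real (Suc n)) \<le> ereal (\<mu> + 1 / real (Suc k))"
        using that by (simp add: frac_le)
      then show ?thesis
        unfolding L_def by (blast intro: order_trans)
    qed
    show "\<exists>n. \<forall>a\<in>L n. \<forall>b\<in>L n. dist a b < e" if "e > 0" for e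
      using shrink[OF that] unfolding L_def by blast
  qed blast
  have "J u \<le> ereal \<mu>"
    by (rule ereal_le_if_le_add_inverse_Suc) (use u_in_sublevels in \<open>simp add: L_def\<close>)
  moreover have "u \<in> S"
    using u_in_sublevels by (simp add: L_def)
  moreover have "ereal \<mu> \<le> J u"
    unfolding Inf[symmetric] using \<open>u \<in> S\<close> by (rule INF_lower)
  ultimately show thesis
    using that by simp
qed

lemma midpoint_strongly_convex_near_Inf:
  fixes J :: "'b::real_normed_vector \<Rightarrow> ereal"
  assumes Inf: "(INF z\<in>S. J z) = ereal \<mu>"
    and midpoint: "\<exists>w\<in>S. J w \<le> ereal (\<mu> + t - c * (norm (a - b))\<^sup>2)"
  shows "c * (norm (a - b))\<^sup>2 \<le> t"
proof -
  obtain w where "w \<in> S" "J w \<le> ereal (\<mu> + t - c * (norm (a - b))\<^sup>2)"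
    using midpoint by blast
  then have "ereal \<mu> \<le> ereal (\<mu> + t - c * (norm (a - b))\<^sup>2)"
    unfolding Inf[symmetric] by (rule INF_lower2)
  then show ?thesis
    by simp
qed

lemma midpoint_strongly_convex_attains_min:
  fixes J :: "'b::{real_normed_vector, complete_space} \<Rightarrow> ereal"
  assumes closed_lsc: "closed S" "lsc_on S J"
    and finite: "y \<in> S" "J y < \<infinity>" and below: "\<And>z. z \<in> S \<Longrightarrow> ereal m \<le> J z"
    and midpoint: "\<And>a b \<alpha>. \<lbrakk>a \<in> S; b \<in> S; J a \<le> ereal \<alpha>; J b \<le> ereal \<alpha>\<rbrakk> \<Longrightarrow>
      \<exists>w\<in>S. J w \<le> ereal (\<alpha> - c * (norm (a - b))\<^sup>2)" and c_pos: "c > 0"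
  obtains u where "u \<in> S" "\<And>z. z \<in> S \<Longrightarrow> J u \<le> J z"
proof -
  have "(INF z\<in>S. J z) < \<infinity>"
    unfolding INF_less_iff using finite by blast
  moreover have "ereal m \<le> (INF z\<in>S. J z)"
    using below by (rule INF_greatest)
  ultimately obtain \<mu> where Inf_J: "(INF z\<in>S. J z) = ereal \<mu>"
    by (cases "INF z\<in>S. J z") auto
  obtain u where "u \<in> S" "J u = ereal \<mu>"
  proof (rule lsc_attains_Inf_if_sublevels_shrink[OF closed_lsc Inf_J])
    fix e :: real assume "e > 0"
    then obtain n where n_large: "1 / real (Suc n) < c * e\<^sup>2"
      using nat_approx_posE[of "c * e\<^sup>2"] c_pos by auto
    have "dist a b < e" if "a \<in> S" "b \<in> S"
      "J a \<le> ereal (\<mu> + 1 / real (Suc n))" "J b \<le> ereal (\<mu> + 1 / real (Suc n))" for a b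
    proof -
      have "c * (norm (a - b))\<^sup>2 < c * e\<^sup>2"
        using midpoint_strongly_convex_near_Inf[OF Inf_J midpoint[OF that]] n_large
        by (rule le_less_trans)
      then show ?thesis
        using c_pos \<open>e > 0\<close> by (simp add: dist_norm power2_less_imp_less)
    qed
    then show "\<exists>n. \<forall>a\<in>S. \<forall>b\<in>S.
        J a \<le> ereal (\<mu> + 1 / real (Suc n)) \<longrightarrow> J b \<le> ereal (\<mu> + 1 / real (Suc n)) \<longrightarrow> dist a b < e"
      by blast
  qed
  moreover have "ereal \<mu> \<le> J z" if "z \<in> S" for z
    unfolding Inf_J[symmetric] using that by (rule INF_lower)
  ultimately show thesis
    using that by metis
qed

definition prox_objective :: "('b::real_inner \<Rightarrow> ereal) \<Rightarrow> 'b \<Rightarrow> 'b \<Rightarrow> ereal" where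
  "prox_objective \<phi> x z = \<phi> z + ereal (1 / 2 * (norm (x - z))\<^sup>2)"

lemma prox_objective_bounded_below:
  fixes S :: "'b::real_inner set"
  assumes "proper_on S \<phi>" "ereal_convex_on S \<phi>" "lsc_on S \<phi>"
  obtains m where "\<And>z. z \<in> S \<Longrightarrow> ereal m \<le> prox_objective \<phi> x z"
proof -
  obtain y a where finite_at_y: "y \<in> S" "\<phi> y = ereal a"
    using assms(1) unfolding proper_on_def by (metis ereal_cases)
  then obtain r where minorant: "r > 0" "\<And>z. z \<in> S \<Longrightarrow> ereal (a - 1 - norm (z - y) / r) \<le> \<phi> z"
    using ereal_convex_lsc_minorant[OF assms(2,3)] by blast
  have "ereal (a - 1 - norm (x - y) / r - (1 / r)\<^sup>2 / 2) \<le> prox_objective \<phi> x z" if "z \<in> S" for z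
  proof -
    have "norm (z - y) / r \<le> (norm (x - y) + norm (x - z)) / r"
      using minorant(1) norm_triangle_ineq4[of "x - y" "x - z"] by (intro divide_right_mono) auto
    moreover have "0 \<le> (norm (x - z) - 1 / r)\<^sup>2"
      by simp
    then have "norm (x - z) / r \<le> (norm (x - z))\<^sup>2 / 2 + (1 / r)\<^sup>2 / 2"
      by (simp add: power2_diff)
    ultimately have "ereal (a - 1 - norm (x - y) / r - (1 / r)\<^sup>2 / 2)
        \<le> ereal (a - 1 - norm (z - y) / r) + ereal (1 / 2 * (norm (x - z))\<^sup>2)"
      by (simp add: add_divide_distrib)
    also have "\<dots> \<le> prox_objective \<phi> x z"
      unfolding prox_objective_def using minorant(2)[OF that] by (rule add_right_mono)
    finally show ?thesis .
  qed
  then show thesis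
    by (rule that)
qed

lemma norm_diff_midpoint_sq:
  fixes x a b :: "'b::real_inner"
  shows "(norm (x - ((1/2) *\<^sub>R a + (1/2) *\<^sub>R b)))\<^sup>2
    = (norm (x - a))\<^sup>2 / 2 + (norm (x - b))\<^sup>2 / 2 - (norm (a - b))\<^sup>2 / 4"
  by (simp add: power2_norm_eq_inner inner_diff_left inner_diff_right inner_add_left
      inner_add_right inner_commute field_simps)

lemma prox_objective_midpoint_le:
  assumes cvx: "ereal_convex_on S \<phi>" and in_S: "a \<in> S" "b \<in> S"
    and sublevel: "prox_objective \<phi> x a \<le> ereal \<alpha>" "prox_objective \<phi> x b \<le> ereal \<alpha>"
  shows "prox_objective \<phi> x ((1/2) *\<^sub>R a + (1/2) *\<^sub>R b) \<le> ereal (\<alpha> - 1 / 8 * (norm (a - b))\<^sup>2)"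
proof -
  have "\<phi> a \<le> ereal (\<alpha> - 1 / 2 * (norm (x - a))\<^sup>2)" "\<phi> b \<le> ereal (\<alpha> - 1 / 2 * (norm (x - b))\<^sup>2)"
    using sublevel unfolding prox_objective_def by (cases "\<phi> a"; cases "\<phi> b"; simp)+
  then have "\<phi> ((1/2) *\<^sub>R a + (1/2) *\<^sub>R b)
      \<le> ereal (1/2 * (\<alpha> - 1 / 2 * (norm (x - a))\<^sup>2) + 1/2 * (\<alpha> - 1 / 2 * (norm (x - b))\<^sup>2))"
    using in_S by (intro ereal_convex_onD[OF cvx]) auto
  then have "prox_objective \<phi> x ((1/2) *\<^sub>R a + (1/2) *\<^sub>R b)
      \<le> ereal (1/2 * (\<alpha> - 1 / 2 * (norm (x - a))\<^sup>2) + 1/2 * (\<alpha> - 1 / 2 * (norm (x - b))\<^sup>2))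
        + ereal (1 / 2 * (norm (x - ((1/2) *\<^sub>R a + (1/2) *\<^sub>R b)))\<^sup>2)"
    unfolding prox_objective_def by (rule add_right_mono)
  also have "\<dots> = ereal (\<alpha> - 1 / 8 * (norm (a - b))\<^sup>2)"
    by (simp add: norm_diff_midpoint_sq field_simps)
  finally show ?thesis .
qed

lemma prox_on_minimizes:
  fixes S :: "'b::{real_inner, complete_space} set"
  assumes cpc: "closed_proper_convex_on S \<phi>"
  shows "prox_on S \<phi> x \<in> S"
    and "z \<in> S \<Longrightarrow> prox_objective \<phi> x (prox_on S \<phi> x) \<le> prox_objective \<phi> x z"
proof -
  have closed_proper_convex_lsc: "closed S" "proper_on S \<phi>" "ereal_convex_on S \<phi>" "lsc_on S \<phi>"
    using cpc by (auto simp: closed_proper_convex_on_def)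
  obtain m where bounded_below: "\<And>z. z \<in> S \<Longrightarrow> ereal m \<le> prox_objective \<phi> x z"
    using prox_objective_bounded_below[OF closed_proper_convex_lsc(2-4)] by blast
  obtain y where finite_at_y: "y \<in> S" "\<phi> y \<noteq> \<infinity>"
    using closed_proper_convex_lsc(2) by (auto simp: proper_on_def)
  obtain u where u_min: "u \<in> S" "\<And>z. z \<in> S \<Longrightarrow> prox_objective \<phi> x u \<le> prox_objective \<phi> x z"
  proof (rule midpoint_strongly_convex_attains_min
      [OF closed_proper_convex_lsc(1) _ finite_at_y(1) _ bounded_below])
    have "lsc_on S (\<lambda>z. ereal (1 / 2 * (norm (x - z))\<^sup>2))"
      by (intro lsc_on_continuous_on continuous_intros)
    then show "lsc_on S (prox_objective \<phi> x)"
      unfolding prox_objective_def using closed_proper_convex_lsc(2,4)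
      by (intro lsc_on_add) (auto simp: proper_on_def)
    show "prox_objective \<phi> x y < \<infinity>"
      using finite_at_y(2) by (simp add: prox_objective_def)
    show "\<exists>w\<in>S. prox_objective \<phi> x w \<le> ereal (\<alpha> - 1 / 8 * (norm (a - b))\<^sup>2)"
      if "a \<in> S" "b \<in> S" "prox_objective \<phi> x a \<le> ereal \<alpha>" "prox_objective \<phi> x b \<le> ereal \<alpha>" for a b \<alpha>
      using prox_objective_midpoint_le[OF closed_proper_convex_lsc(3) that]
        ereal_convex_on_convex_combination_in[OF closed_proper_convex_lsc(3) that(1,2)]
      by (intro bexI[of _ "(1/2) *\<^sub>R a + (1/2) *\<^sub>R b"]) auto
  qed auto
  then have "is_arg_min (prox_objective \<phi> x) (\<lambda>z. z \<in> S) u"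
    by (auto simp: is_arg_min_def not_less)
  then have "is_arg_min (prox_objective \<phi> x) (\<lambda>z. z \<in> S) (prox_on S \<phi> x)"
    unfolding prox_on_def arg_min_on_def arg_min_def prox_objective_def[symmetric] by (rule someI)
  then show "prox_on S \<phi> x \<in> S"
    and "z \<in> S \<Longrightarrow> prox_objective \<phi> x (prox_on S \<phi> x) \<le> prox_objective \<phi> x z"
    by (auto simp: is_arg_min_def not_less)
qed

lemma prox_on_finite:
  fixes S :: "'b::{real_inner, complete_space} set"
  assumes cpc: "closed_proper_convex_on S \<phi>"
  shows "\<bar>\<phi> (prox_on S \<phi> x)\<bar> \<noteq> \<infinity>"
proof -
  obtain y where "y \<in> S" "\<phi> y \<noteq> \<infinity>" and "\<phi> (prox_on S \<phi> x) \<noteq> -\<infinity>"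
    using cpc prox_on_minimizes(1)[OF cpc] by (auto simp: closed_proper_convex_on_def proper_on_def)
  moreover have "\<phi> (prox_on S \<phi> x) \<noteq> \<infinity>"
    using prox_on_minimizes(2)[OF cpc \<open>y \<in> S\<close>, of x] \<open>\<phi> y \<noteq> \<infinity>\<close> by (auto simp: prox_objective_def)
  ultimately show ?thesis
    by auto
qed

lemma le_if_le_add_small_multiple:
  fixes a b k :: real
  assumes "\<And>t. 0 < t \<Longrightarrow> t < 1 \<Longrightarrow> a \<le> b + t * k"
  shows "a \<le> b"
proof (rule tendsto_lowerbound)
  show "((\<lambda>t. b + t * k) \<longlongrightarrow> b) (at_right 0)"
    by (auto intro!: tendsto_eq_intros)
  show "\<forall>\<^sub>F t in at_right 0. a \<le> b + t * k"
    using eventually_at_right_real[of 0 "1::real"] assms by (auto elim!: eventually_mono)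
qed simp

lemma prox_on_variational:
  fixes S :: "'b::{real_inner, complete_space} set"
  assumes cpc: "closed_proper_convex_on S \<phi>" and u_eq: "u = prox_on S \<phi> x" and z_in: "z \<in> S"
  shows "\<phi> u + ereal ((x - u) \<bullet> (z - u)) \<le> \<phi> z"
proof -
  have proper_convex: "proper_on S \<phi>" "ereal_convex_on S \<phi>" and "u \<in> S"
    using cpc prox_on_minimizes(1)[OF cpc] u_eq by (auto simp: closed_proper_convex_on_def)
  obtain a where \<phi>_u: "\<phi> u = ereal a"
    using prox_on_finite[OF cpc, of x] u_eq by auto
  have "(x - u) \<bullet> (z - u) \<le> b - a" if \<phi>_z: "\<phi> z = ereal b" for b
  proof (rule le_if_le_add_small_multiple)
    fix t :: real assume t_bounds: "0 < t" "t < 1"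
    define w where "w = (1 - t) *\<^sub>R u + t *\<^sub>R z"
    have "ereal (a + 1 / 2 * (norm (x - u))\<^sup>2) \<le> prox_objective \<phi> x w"
      using prox_on_minimizes(2)[OF cpc, of w x] t_bounds
        ereal_convex_on_convex_combination_in[OF proper_convex(2) \<open>u \<in> S\<close> z_in]
      by (simp add: u_eq[symmetric] \<phi>_u prox_objective_def w_def)
    also have "\<dots> \<le> ereal ((1 - t) * a + t * b) + ereal (1 / 2 * (norm (x - w))\<^sup>2)"
      unfolding prox_objective_def w_def using \<open>u \<in> S\<close> z_in t_bounds \<phi>_u \<phi>_z
      by (intro add_right_mono ereal_convex_onD[OF proper_convex(2)]) auto
    finally have "a + 1 / 2 * (norm (x - u))\<^sup>2 \<le> (1 - t) * a + t * b + 1 / 2 * (norm (x - w))\<^sup>2"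
      by simp
    moreover have "x - w = (x - u) - t *\<^sub>R (z - u)"
      by (simp add: w_def algebra_simps)
    then have "(norm (x - w))\<^sup>2
        = (norm (x - u))\<^sup>2 - 2 * t * ((x - u) \<bullet> (z - u)) + t * (t * (norm (z - u))\<^sup>2)"
      by (simp only: power2_norm_eq_inner inner_diff_left inner_diff_right inner_scaleR_left
          inner_scaleR_right inner_commute)
    ultimately have "t * ((x - u) \<bullet> (z - u)) \<le> t * (b - a + t * ((norm (z - u))\<^sup>2 / 2))"
      by (simp add: algebra_simps)
    then show "(x - u) \<bullet> (z - u) \<le> b - a + t * ((norm (z - u))\<^sup>2 / 2)"
      using t_bounds by simp
  qed
  then show ?thesis
    using proper_convex(1) z_in \<phi>_u by (cases "\<phi> z") (auto simp: proper_on_def algebra_simps)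
qed

section \<open>Projections, the Riesz representation and gradients on closed subspaces\<close>

lemma closed_convex_projection:
  fixes C :: "'b::{real_inner, complete_space} set"
  assumes "closed C" "convex C" "C \<noteq> {}"
  obtains u where "u \<in> C" "\<And>z. z \<in> C \<Longrightarrow> (x - u) \<bullet> (z - u) \<le> 0"
proof -
  have "closed_proper_convex_on C (\<lambda>_. ereal 0)"
    using assms by (intro closed_proper_convex_on_real) (auto simp: convex_on_const)
  from prox_on_minimizes(1)[OF this] prox_on_variational[OF this refl] show thesis
    by (intro that[of "prox_on C (\<lambda>_. ereal 0) x"]) auto
qed

text \<open>The representing vector is the proximal point of \<open>-L\<close> at \<open>0\<close>, which minimizes
  \<open>\<parallel>v\<parallel>\<^sup>2 / 2 - L v\<close>.\<close>

lemma riesz_representation_on: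
  fixes S :: "'b::{real_inner, complete_space} set"
  assumes closed_subspace: "subspace S" "closed S" and "bounded_linear L"
  obtains g where "g \<in> S" "\<And>v. v \<in> S \<Longrightarrow> L v = g \<bullet> v"
proof -
  interpret L: bounded_linear L by fact
  define \<phi> where "\<phi> v = ereal (- L v)" for v
  have cpc: "closed_proper_convex_on S \<phi>"
    unfolding \<phi>_def
  proof (rule closed_proper_convex_on_real)
    show "convex_on S (\<lambda>v. - L v)"
      using subspace_imp_convex[OF closed_subspace(1)] by (auto simp: convex_on_def L.add L.scaleR)
    show "continuous_on S (\<lambda>v. - L v)"
      by (intro continuous_intros linear_continuous_on[OF L.bounded_linear_axioms])
  qed (use closed_subspace subspace_0 in auto)
  define u where "u = prox_on S \<phi> 0"
  have "u \<in> S"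
    unfolding u_def by (rule prox_on_minimizes(1)[OF cpc])
  have functional_le: "L v \<le> u \<bullet> v" if "v \<in> S" for v
    using prox_on_variational[OF cpc u_def subspace_add[OF closed_subspace(1) \<open>u \<in> S\<close> that]]
    by (simp add: \<phi>_def L.add)
  have "L v = u \<bullet> v" if "v \<in> S" for v
    using functional_le[OF that] functional_le[OF subspace_neg[OF closed_subspace(1) that]]
    by (simp add: linear_neg[OF L.linear])
  then show thesis
    using that \<open>u \<in> S\<close> by blast
qed

lemma has_derivative_on_line:
  assumes S_subspace: "subspace S" and f_deriv: "(f has_derivative f') (at x within S)"
    and in_S: "x \<in> S" "v \<in> S"
  shows "((\<lambda>t. f (x + t *\<^sub>R v)) has_field_derivative f' v) (at 0)"
proof -
  have "((\<lambda>t. x + t *\<^sub>R v) has_derivative (\<lambda>t. t *\<^sub>R v)) (at 0)"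
    by (auto intro!: derivative_eq_intros)
  moreover have "(\<lambda>t. x + t *\<^sub>R v) ` UNIV \<subseteq> S"
    using S_subspace in_S by (auto intro: subspace_add subspace_scale)
  then have "(f has_derivative f') (at (x + 0 *\<^sub>R v) within (\<lambda>t. x + t *\<^sub>R v) ` UNIV)"
    using f_deriv has_derivative_subset by auto
  ultimately have "((\<lambda>t. f (x + t *\<^sub>R v)) has_derivative (\<lambda>t. f' (t *\<^sub>R v))) (at 0)"
    using has_derivative_in_compose[of "\<lambda>t. x + t *\<^sub>R v" _ 0 UNIV f f'] by simp
  moreover have "f' (t *\<^sub>R v) = t * f' v" for t
    using has_derivative_linear[OF f_deriv] linear_scale by fastforce
  ultimately show ?thesis
    unfolding has_field_derivative_def by (simp add: mult_commute_abs)
qed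

lemma has_derivative_subspace_cong:
  assumes S_subspace: "subspace S" "x \<in> S" and f_deriv: "(f has_derivative f') (at x within S)"
    and cong: "bounded_linear f''" "\<And>v. v \<in> S \<Longrightarrow> f' v = f'' v"
  shows "(f has_derivative f'') (at x within S)"
  unfolding has_derivative_within
proof (intro conjI cong(1))
  have "((\<lambda>y. (1 / norm (y - x)) *\<^sub>R (f y - (f x + f' (y - x)))) \<longlongrightarrow> 0) (at x within S)"
    using f_deriv unfolding has_derivative_within by blast
  then show "((\<lambda>y. (1 / norm (y - x)) *\<^sub>R (f y - (f x + f'' (y - x)))) \<longlongrightarrow> 0) (at x within S)"
    by (rule Lim_transform_eventually)
      (auto simp: eventually_at_filter cong(2) subspace_diff[OF S_subspace(1) _ S_subspace(2)])
qed

lemma has_derivative_gradient_on: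
  fixes S :: "'b::{real_inner, complete_space} set"
  assumes closed_subspace: "subspace S" "closed S"
    and f_diff: "f differentiable (at x within S)" and x_in: "x \<in> S"
  shows "(f has_derivative (\<lambda>v. gradient_on S f x \<bullet> v)) (at x within S)"
proof -
  obtain f' where f_deriv: "(f has_derivative f') (at x within S)"
    using f_diff unfolding differentiable_def by blast
  obtain g where g_represents: "g \<in> S" "\<And>v. v \<in> S \<Longrightarrow> f' v = g \<bullet> v"
    using riesz_representation_on[OF closed_subspace has_derivative_bounded_linear[OF f_deriv]]
    by blast
  have "(f has_derivative (\<lambda>v. g \<bullet> v)) (at x within S)"
    by (rule has_derivative_subspace_cong
        [OF closed_subspace(1) x_in f_deriv bounded_linear_inner_right g_represents(2)])
  moreover have "g1 = g2"
    if "g1 \<in> S" "(f has_derivative (\<lambda>v. g1 \<bullet> v)) (at x within S)"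
      "g2 \<in> S" "(f has_derivative (\<lambda>v. g2 \<bullet> v)) (at x within S)" for g1 g2
  proof -
    have "g1 - g2 \<in> S"
      using that subspace_diff[OF closed_subspace(1)] by blast
    then have "g1 \<bullet> (g1 - g2) = g2 \<bullet> (g1 - g2)"
      using that has_derivative_on_line[OF closed_subspace(1) _ x_in] by (metis DERIV_unique)
    then show ?thesis
      by (metis eq_iff_diff_eq_0 inner_diff_left inner_eq_zero_iff)
  qed
  ultimately have "\<exists>!g. g \<in> S \<and> (f has_derivative (\<lambda>v. g \<bullet> v)) (at x within S)"
    by (intro ex1I[of _ g]) (use g_represents(1) in auto)
  then show ?thesis
    using theI'[of "\<lambda>g. g \<in> S \<and> (f has_derivative (\<lambda>v. g \<bullet> v)) (at x within S)"]
    unfolding gradient_on_def by blast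
qed

lemma convex_on_gradient_inequality:
  fixes S :: "'b::{real_inner, complete_space} set"
  assumes closed_subspace: "subspace S" "closed S" and cvx: "convex_on S f"
    and f_diff: "f differentiable (at x within S)" and x_in: "x \<in> S" and z_in: "z \<in> S"
  shows "f x + gradient_on S f x \<bullet> (z - x) \<le> f z"
proof -
  have direction_in: "z - x \<in> S"
    using subspace_diff closed_subspace x_in z_in by blast
  have "convex_on UNIV (\<lambda>t::real. f (x + t *\<^sub>R (z - x)))"
  proof (rule convex_onI)
    fix t a b :: real assume t_bounds: "0 < t" "t < 1"
    have "f ((1 - t) *\<^sub>R (x + a *\<^sub>R (z - x)) + t *\<^sub>R (x + b *\<^sub>R (z - x)))
      \<le> (1 - t) * f (x + a *\<^sub>R (z - x)) + t * f (x + b *\<^sub>R (z - x))"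
      using t_bounds closed_subspace(1) x_in direction_in
      by (intro convex_onD[OF cvx]) (auto intro!: subspace_add subspace_scale)
    also have "(1 - t) *\<^sub>R (x + a *\<^sub>R (z - x)) + t *\<^sub>R (x + b *\<^sub>R (z - x))
        = x + ((1 - t) *\<^sub>R a + t *\<^sub>R b) *\<^sub>R (z - x)"
      by (simp add: algebra_simps)
    finally show "f (x + ((1 - t) *\<^sub>R a + t *\<^sub>R b) *\<^sub>R (z - x))
        \<le> (1 - t) * f (x + a *\<^sub>R (z - x)) + t * f (x + b *\<^sub>R (z - x))" .
  qed simp
  moreover have "((\<lambda>t. f (x + t *\<^sub>R (z - x)))
      has_field_derivative gradient_on S f x \<bullet> (z - x)) (at 0)"
    by (rule has_derivative_on_line[OF closed_subspace(1) _ x_in direction_in])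
      (rule has_derivative_gradient_on[OF closed_subspace f_diff x_in])
  ultimately show ?thesis
    using convex_on_imp_above_tangent[where A = UNIV and c = 0 and x = 1] by fastforce
qed

section \<open>Weak convergence\<close>

abbreviation weakly_tendsto :: "(nat \<Rightarrow> 'b::real_inner) \<Rightarrow> 'b \<Rightarrow> bool" where
  "weakly_tendsto X l \<equiv> weakly_tendsto_on UNIV X l"

lemma weakly_tendstoD: "weakly_tendsto X l \<Longrightarrow> (\<lambda>n. X n \<bullet> y) \<longlonglongrightarrow> l \<bullet> y"
  by (simp add: weakly_tendsto_on_def)

lemma weak_limit_in_closed_convex:
  fixes C :: "'b::{real_inner, complete_space} set"
  assumes closed_convex: "closed C" "convex C" and eventually_in: "\<forall>\<^sub>F n in sequentially. X n \<in> C"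
    and lim: "weakly_tendsto X l"
  shows "l \<in> C"
proof -
  have "C \<noteq> {}"
    using eventually_happens[OF eventually_in] by auto
  then obtain u where projection: "u \<in> C" "\<And>z. z \<in> C \<Longrightarrow> (l - u) \<bullet> (z - u) \<le> 0"
    using closed_convex_projection[OF closed_convex] by metis
  have "(\<lambda>n. X n \<bullet> (l - u) - u \<bullet> (l - u)) \<longlonglongrightarrow> l \<bullet> (l - u) - u \<bullet> (l - u)"
    by (intro tendsto_intros weakly_tendstoD lim)
  moreover have "\<forall>\<^sub>F n in sequentially. X n \<bullet> (l - u) - u \<bullet> (l - u) \<le> 0"
    using eventually_in
    by eventually_elim (use projection(2) in \<open>metis inner_commute inner_diff_left\<close>)
  ultimately have "l \<bullet> (l - u) - u \<bullet> (l - u) \<le> 0"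
    using tendsto_upperbound by (metis trivial_limit_sequentially)
  then have "(l - u) \<bullet> (l - u) \<le> 0"
    by (simp add: inner_diff_left)
  then have "l = u"
    by (metis eq_iff_diff_eq_0 inner_ge_zero inner_eq_zero_iff order_antisym)
  with projection(1) show ?thesis
    by simp
qed

lemma weak_limit_lsc:
  fixes S :: "'b::{real_inner, complete_space} set"
  assumes cpc: "closed_proper_convex_on S \<phi>" and X_in: "\<And>n. X n \<in> S"
    and values_tendsto: "(\<lambda>n. \<phi> (X n)) \<longlonglongrightarrow> c"
    and lim: "weakly_tendsto X l"
  shows "l \<in> S" "\<phi> l \<le> c"
proof -
  have closed_convex_lsc: "closed S" "convex S" "ereal_convex_on S \<phi>" "lsc_on S \<phi>"
    using cpc by (auto simp: closed_proper_convex_on_def ereal_convex_on_def)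
  show "l \<in> S"
    by (rule weak_limit_in_closed_convex[OF closed_convex_lsc(1,2) _ lim]) (simp add: X_in)
  show "\<phi> l \<le> c"
  proof (rule dense_ge)
    fix b assume "c < b"
    from order_tendstoD(2)[OF values_tendsto this]
    have "\<forall>\<^sub>F n in sequentially. X n \<in> {x \<in> S. \<phi> x \<le> b}"
      by eventually_elim (simp add: X_in)
    then have "l \<in> {x \<in> S. \<phi> x \<le> b}"
      using closed_sublevel[OF closed_convex_lsc(1,4)] convex_sublevel[OF closed_convex_lsc(3)] lim
      by (intro weak_limit_in_closed_convex)
    then show "\<phi> l \<le> b"
      by simp
  qed
qed

lemma convergent_lipschitz_closure:
  fixes g :: "nat \<Rightarrow> 'b::metric_space \<Rightarrow> 'c::complete_space"
  assumes lip: "\<And>n. L-lipschitz_on UNIV (g n)" and conv: "\<And>d. d \<in> D \<Longrightarrow> convergent (\<lambda>n. g n d)"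
    and y_in: "y \<in> closure D"
  shows "convergent (\<lambda>n. g n y)"
proof (rule Cauchy_convergent, rule metric_CauchyI)
  fix e :: real assume "e > 0"
  have "L \<ge> 0"
    using lip by (rule lipschitz_on_nonneg)
  with \<open>e > 0\<close> obtain d where d_near: "d \<in> D" "dist d y < e / (3 * (L + 1))"
    using y_in by (auto simp: closure_approachable dest!: spec[of _ "e / (3 * (L + 1))"])
  have near: "dist (g n d) (g n y) < e / 3" for n
  proof -
    have "dist (g n d) (g n y) \<le> L * dist d y"
      by (rule lipschitz_onD[OF lip]) auto
    also have "\<dots> \<le> (L + 1) * dist d y"
      by (simp add: distrib_right)
    also have "\<dots> < (L + 1) * (e / (3 * (L + 1)))"
      using d_near(2) \<open>L \<ge> 0\<close> by (intro mult_strict_left_mono) auto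
    also have "\<dots> = e / 3"
      using \<open>L \<ge> 0\<close> by (simp add: field_simps)
    finally show ?thesis .
  qed
  obtain N where cauchy_at_d: "\<And>m n. m \<ge> N \<Longrightarrow> n \<ge> N \<Longrightarrow> dist (g m d) (g n d) < e / 3"
    using metric_CauchyD[OF convergent_Cauchy[OF conv[OF d_near(1)]], of "e / 3"] \<open>e > 0\<close> by auto
  have "dist (g m y) (g n y) < e" if "m \<ge> N" "n \<ge> N" for m n
    using dist_triangle3[of "g m y" "g n y" "g m d"] dist_triangle[of "g m d" "g n y" "g n d"]
      near[of m] near[of n] cauchy_at_d[OF that] by linarith
  then show "\<exists>N. \<forall>m\<ge>N. \<forall>n\<ge>N. dist (g m y) (g n y) < e"
    by blast
qed

lemma lipschitz_on_inner:
  assumes "norm x \<le> B"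
  shows "B-lipschitz_on UNIV (\<lambda>y. x \<bullet> y)"
proof (rule lipschitz_onI)
  fix y z
  have "\<bar>x \<bullet> (y - z)\<bar> \<le> norm x * norm (y - z)"
    by (rule Cauchy_Schwarz_ineq2)
  also have "\<dots> \<le> B * norm (y - z)"
    using assms by (rule mult_right_mono) simp
  finally show "dist (x \<bullet> y) (x \<bullet> z) \<le> B * dist y z"
    by (simp add: dist_norm inner_diff_right)
qed (use assms norm_ge_zero order_trans in blast)

lemma lipschitz_on_norm_diff: "1-lipschitz_on UNIV (\<lambda>z. norm (x - z))"
proof (rule lipschitz_onI)
  show "dist (norm (x - y)) (norm (x - z)) \<le> 1 * dist y z" for y z
    using norm_triangle_ineq3[of "x - y" "x - z"] by (simp add: dist_norm norm_minus_commute)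
qed simp

lemma bounded_inner_convergent_imp_weakly_tendsto:
  fixes X :: "nat \<Rightarrow> 'b::{real_inner, complete_space}"
  assumes bounded: "\<And>n. norm (X n) \<le> B" and conv: "\<And>y. convergent (\<lambda>n. X n \<bullet> y)"
  obtains l where "weakly_tendsto X l"
proof -
  define L where "L y = lim (\<lambda>n. X n \<bullet> y)" for y
  have tendsto_L: "(\<lambda>n. X n \<bullet> y) \<longlonglongrightarrow> L y" for y
    using conv[of y] unfolding L_def convergent_LIMSEQ_iff .
  have "bounded_linear L"
  proof (rule bounded_linear_intro)
    show "L (a + b) = L a + L b" for a b
      using tendsto_add[OF tendsto_L tendsto_L] tendsto_L[of "a + b"]
      by (auto simp: inner_add_right intro: LIMSEQ_unique)
    show "L (c *\<^sub>R a) = c *\<^sub>R L a" for c a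
      using tendsto_mult[OF tendsto_const tendsto_L, of c] tendsto_L[of "c *\<^sub>R a"]
      by (auto intro: LIMSEQ_unique)
    show "norm (L a) \<le> norm a * B" for a
    proof (rule LIMSEQ_le_const2[OF tendsto_norm[OF tendsto_L]])
      have "norm (X n \<bullet> a) \<le> norm a * B" for n
        using Cauchy_Schwarz_ineq2[of "X n" a] mult_right_mono[OF bounded[of n], of "norm a"]
        by (simp add: mult.commute)
      then show "\<exists>N. \<forall>n\<ge>N. norm (X n \<bullet> a) \<le> norm a * B"
        by blast
    qed
  qed
  then obtain l where represents: "\<And>y. L y = l \<bullet> y"
    using riesz_representation_on[OF subspace_UNIV closed_UNIV] by (metis UNIV_I)
  show thesis
    using tendsto_L by (intro that[of l]) (simp add: weakly_tendsto_on_def represents)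
qed

lemma bounded_imp_weakly_convergent_subsequence:
  fixes X :: "nat \<Rightarrow> 'b::{real_inner, complete_space, second_countable_topology}"
  assumes bounded: "\<And>n. norm (X n) \<le> B"
  obtains r l where "strict_mono (r :: nat \<Rightarrow> nat)" "weakly_tendsto (X \<circ> r) l"
proof -
  obtain D :: "'b set" where dense: "countable D" "UNIV \<subseteq> closure D"
    using separable by metis
  have "norm (X n \<bullet> sgn d) \<le> B" for n d
  proof -
    have "\<bar>X n \<bullet> sgn d\<bar> \<le> norm (X n) * norm (sgn d)"
      by (rule Cauchy_Schwarz_ineq2)
    also have "\<dots> \<le> norm (X n) * 1"
      by (intro mult_left_mono) (auto simp: norm_sgn)
    finally show ?thesis
      using bounded[of n] by simp
  qed
  then obtain r where subseq: "strict_mono (r :: nat \<Rightarrow> nat)"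
    "\<And>d. d \<in> D \<Longrightarrow> \<exists>l. (\<lambda>n. X (r n) \<bullet> sgn d) \<longlonglongrightarrow> l"
    using function_convergent_subsequence[OF dense(1), of "\<lambda>n d. X n \<bullet> sgn d" B] by metis
  have convergent_D: "convergent (\<lambda>n. X (r n) \<bullet> d)" if "d \<in> D" for d
  proof -
    have "convergent (\<lambda>n. norm d * (X (r n) \<bullet> sgn d))"
      using subseq(2)[OF that]
      by (intro convergent_mult convergent_const) (simp add: convergent_def)
    moreover have "norm d * (X (r n) \<bullet> sgn d) = X (r n) \<bullet> d" for n
      by (cases "d = 0") (auto simp: sgn_div_norm)
    ultimately show ?thesis
      by simp
  qed
  have "convergent (\<lambda>n. X (r n) \<bullet> y)" for y
    by (rule convergent_lipschitz_closure[OF lipschitz_on_inner[OF bounded] convergent_D])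
      (use dense(2) in auto)
  then obtain l where "weakly_tendsto (X \<circ> r) l"
    using bounded_inner_convergent_imp_weakly_tendsto[of "X \<circ> r" B] bounded by auto
  with subseq(1) show thesis
    using that by blast
qed

lemma convergent_norm_diff_imp_inner:
  fixes X :: "nat \<Rightarrow> 'b::real_inner"
  assumes "convergent (\<lambda>n. norm (X n - a))" "convergent (\<lambda>n. norm (X n - b))"
  shows "convergent (\<lambda>n. X n \<bullet> (a - b))"
proof -
  obtain \<alpha> \<beta> where "(\<lambda>n. norm (X n - a)) \<longlonglongrightarrow> \<alpha>" "(\<lambda>n. norm (X n - b)) \<longlonglongrightarrow> \<beta>"
    using assms by (auto simp: convergent_def)
  then have "(\<lambda>n. ((norm (X n - b))\<^sup>2 - (norm (X n - a))\<^sup>2 + (a \<bullet> a - b \<bullet> b)) / 2)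
      \<longlonglongrightarrow> (\<beta>\<^sup>2 - \<alpha>\<^sup>2 + (a \<bullet> a - b \<bullet> b)) / 2"
    by (intro tendsto_intros) auto
  moreover have "((norm (X n - b))\<^sup>2 - (norm (X n - a))\<^sup>2 + (a \<bullet> a - b \<bullet> b)) / 2
      = X n \<bullet> (a - b)" for n
    by (simp add: power2_norm_eq_inner inner_diff_left inner_diff_right inner_commute)
  ultimately show ?thesis
    by (auto simp: convergent_def)
qed

lemma weakly_tendsto_if_subsequences:
  fixes X :: "nat \<Rightarrow> 'b::{real_inner, complete_space, second_countable_topology}"
  assumes bounded: "\<And>n. norm (X n) \<le> B"
    and unique: "\<And>r k. strict_mono r \<Longrightarrow> weakly_tendsto (X \<circ> r) k \<Longrightarrow> k = l"
  shows "weakly_tendsto X l"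
  unfolding weakly_tendsto_on_def
proof (intro ballI, rule ccontr)
  fix y assume "\<not> (\<lambda>n. X n \<bullet> y) \<longlonglongrightarrow> l \<bullet> y"
  then obtain e where "e > 0" and "\<exists>\<^sub>\<infinity>n. dist (X n \<bullet> y) (l \<bullet> y) \<ge> e"
    unfolding tendsto_iff by (auto simp: not_eventually not_less cofinite_eq_sequentially)
  then obtain s where far: "strict_mono (s :: nat \<Rightarrow> nat)" "\<And>n. dist (X (s n) \<bullet> y) (l \<bullet> y) \<ge> e"
    using infinite_enumerate[of "{n. dist (X n \<bullet> y) (l \<bullet> y) \<ge> e}"]
    by (auto simp: frequently_cofinite)
  obtain r k where subseq: "strict_mono (r :: nat \<Rightarrow> nat)" "weakly_tendsto (X \<circ> (s \<circ> r)) k"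
    using bounded_imp_weakly_convergent_subsequence[of "X \<circ> s" B] bounded by (auto simp: o_assoc)
  have "k = l"
    using strict_mono_o[OF far(1) subseq(1)] subseq(2) by (rule unique)
  then have "(\<lambda>n. dist (X (s (r n)) \<bullet> y) (l \<bullet> y)) \<longlonglongrightarrow> 0"
    using weakly_tendstoD[OF subseq(2), of y] by (simp add: tendsto_dist_iff[symmetric])
  then have "e \<le> 0"
    using far(2) by (intro LIMSEQ_le_const) auto
  with \<open>e > 0\<close> show False
    by simp
qed

lemma opial:
  fixes X :: "nat \<Rightarrow> 'b::{real_inner, complete_space, second_countable_topology}"
  assumes "S \<noteq> {}" and conv: "\<And>z. z \<in> S \<Longrightarrow> convergent (\<lambda>n. norm (X n - z))"
    and cluster: "\<And>r l. strict_mono r \<Longrightarrow> weakly_tendsto (X \<circ> r) l \<Longrightarrow> l \<in> S"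
  obtains l where "l \<in> S" "weakly_tendsto X l"
proof -
  obtain z where "z \<in> S"
    using \<open>S \<noteq> {}\<close> by blast
  then obtain K where bounded_diff: "\<And>n. norm (X n - z) \<le> K"
    using convergent_imp_Bseq[OF conv] unfolding Bseq_def by auto
  have bounded: "norm (X n) \<le> K + norm z" for n
    using norm_triangle_ineq[of "X n - z" z] bounded_diff[of n] by simp
  obtain r l where cluster_l: "strict_mono r" "weakly_tendsto (X \<circ> r) l"
    using bounded_imp_weakly_convergent_subsequence[of X, OF bounded] by blast
  have "k = l" if cluster_k: "strict_mono s" "weakly_tendsto (X \<circ> s) k" for s k
  proof -
    obtain c where tendsto_c: "(\<lambda>n. X n \<bullet> (k - l)) \<longlonglongrightarrow> c"
      using convergent_norm_diff_imp_inner[OF conv conv] cluster cluster_l cluster_k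
      unfolding convergent_def by metis
    have "j \<bullet> (k - l) = c" if "strict_mono q" "weakly_tendsto (X \<circ> q) j" for q j
      using LIMSEQ_subseq_LIMSEQ[OF tendsto_c that(1)] weakly_tendstoD[OF that(2), of "k - l"]
      by (simp add: o_def LIMSEQ_unique)
    from this[OF cluster_k] this[OF cluster_l] have "(k - l) \<bullet> (k - l) = 0"
      by (simp add: inner_diff_left)
    then show ?thesis
      by simp
  qed
  then have "weakly_tendsto X l"
    by (rule weakly_tendsto_if_subsequences[OF bounded])
  with cluster[OF cluster_l] show thesis
    by (rule that)
qed

text \<open>The exceptional null set for the convergence of the norms depends on \<open>z\<close>; separability of \<open>S\<close>
  makes it uniform.\<close>

lemma AE_opial:
  fixes X :: "nat \<Rightarrow> 'w \<Rightarrow> 'b::{real_inner, complete_space, second_countable_topology}"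
  assumes "S \<noteq> {}" and conv: "\<And>z. z \<in> S \<Longrightarrow> AE \<omega> in M. convergent (\<lambda>n. norm (X n \<omega> - z))"
    and cluster: "AE \<omega> in M. \<forall>r l. strict_mono r \<longrightarrow> weakly_tendsto ((\<lambda>n. X n \<omega>) \<circ> r) l \<longrightarrow> l \<in> S"
  shows "AE \<omega> in M. \<exists>l\<in>S. weakly_tendsto (\<lambda>n. X n \<omega>) l"
proof -
  obtain D where dense: "countable D" "D \<subseteq> S" "S \<subseteq> closure D"
    using separable by metis
  have "AE \<omega> in M. \<forall>z\<in>D. convergent (\<lambda>n. norm (X n \<omega> - z))"
    using conv dense(2) by (subst AE_ball_countable[OF dense(1)]) blast
  then show ?thesis
    using cluster
  proof eventually_elim
    case (elim \<omega>)
    have convergent_S: "convergent (\<lambda>n. norm (X n \<omega> - z))" if "z \<in> S" for z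
      by (rule convergent_lipschitz_closure[OF lipschitz_on_norm_diff, where D = D])
        (use elim(1) dense(3) that in auto)
    obtain l where "l \<in> S" "weakly_tendsto (\<lambda>n. X n \<omega>) l"
      using opial[OF \<open>S \<noteq> {}\<close> convergent_S] elim(2) by metis
    then show ?case
      by blast
  qed
qed

lemma norm_le_iff_countable_dense:
  fixes v :: "'b::real_inner"
  assumes dense: "UNIV \<subseteq> closure D" and "r \<ge> 0"
  shows "norm v \<le> r \<longleftrightarrow> (\<forall>d\<in>D. v \<bullet> d \<le> r * norm d)"
proof
  assume "norm v \<le> r"
  then show "\<forall>d\<in>D. v \<bullet> d \<le> r * norm d"
    using norm_cauchy_schwarz order_trans mult_right_mono norm_ge_zero by metis
next
  assume dense_le: "\<forall>d\<in>D. v \<bullet> d \<le> r * norm d"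
  have "closed {y. v \<bullet> y \<le> r * norm y}"
    by (intro closed_Collect_le continuous_intros)
  then have "closure D \<subseteq> {y. v \<bullet> y \<le> r * norm y}"
    using dense_le by (intro closure_minimal) auto
  then have "v \<bullet> v \<le> r * norm v"
    using dense by blast
  then show "norm v \<le> r"
    using \<open>r \<ge> 0\<close> by (cases "v = 0") (auto simp: power2_norm_eq_inner[symmetric] power2_eq_square)
qed

lemma borel_measurable_norm_if_inner:
  fixes g :: "'w \<Rightarrow> 'b::{real_inner, second_countable_topology}"
  assumes [measurable]: "\<And>y. (\<lambda>\<omega>. g \<omega> \<bullet> y) \<in> borel_measurable M"
  shows "(\<lambda>\<omega>. norm (g \<omega>)) \<in> borel_measurable M"
proof (rule borel_measurableI_le)
  fix r
  obtain D :: "'b set" where dense: "countable D" "UNIV \<subseteq> closure D"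
    using separable by metis
  show "{\<omega> \<in> space M. norm (g \<omega>) \<le> r} \<in> sets M"
  proof (cases "r \<ge> 0")
    case True
    have "{\<omega> \<in> space M. \<forall>d\<in>D. g \<omega> \<bullet> d \<le> r * norm d} \<in> sets M"
      using dense(1) by measurable
    then show ?thesis
      by (simp add: norm_le_iff_countable_dense[OF dense(2) True])
  next
    case False
    then have "\<not> norm (g \<omega>) \<le> r" for \<omega>
      using norm_ge_zero[of "g \<omega>"] by linarith
    then show ?thesis
      by simp
  qed
qed

lemma borel_eq_sigma_balls:
  "(borel :: 'b::{metric_space, second_countable_topology} measure)
    = sigma UNIV (range (\<lambda>(c, r). ball c r))"
proof (rule second_countable_borel_measurable, intro ext iffI)
  fix U :: "'b set"
  assume "open U"
  then have "U = \<Union> {ball c r |c r. ball c r \<subseteq> U}"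
    by (auto simp: open_contains_ball) (metis centre_in_ball mem_ball)
  moreover have "generate_topology (range (\<lambda>(c, r). ball c r)) (\<Union> {ball c r |c r. ball c r \<subseteq> U})"
    by (intro generate_topology.UN generate_topology.Basis) auto
  ultimately show "generate_topology (range (\<lambda>(c, r). ball c r)) U"
    by simp
next
  fix U :: "'b set"
  assume "generate_topology (range (\<lambda>(c, r). ball c r)) U"
  then show "open U"
    by (induction rule: generate_topology.induct) auto
qed

lemma borel_measurable_if_inner:
  fixes g :: "'w \<Rightarrow> 'b::{real_inner, second_countable_topology}"
  assumes inner_measurable: "\<And>y. (\<lambda>\<omega>. g \<omega> \<bullet> y) \<in> borel_measurable M"
  shows "g \<in> borel_measurable M"
  unfolding borel_eq_sigma_balls
proof (rule measurable_sigma_sets)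
  fix U assume "U \<in> range (\<lambda>(c :: 'b, r). ball c r)"
  then obtain c r where U_eq: "U = ball c r"
    by auto
  have [measurable]: "(\<lambda>\<omega>. norm (g \<omega> - c)) \<in> borel_measurable M"
  proof (rule borel_measurable_norm_if_inner)
    show "(\<lambda>\<omega>. (g \<omega> - c) \<bullet> y) \<in> borel_measurable M" for y
      unfolding inner_diff_left using inner_measurable by measurable
  qed
  have "{\<omega> \<in> space M. norm (g \<omega> - c) < r} \<in> sets M"
    by measurable
  also have "{\<omega> \<in> space M. norm (g \<omega> - c) < r} = g -` U \<inter> space M"
    by (auto simp: U_eq dist_norm norm_minus_commute)
  finally show "g -` U \<inter> space M \<in> sets M" .
qed auto

lemma measurable_weak_limit:
  fixes X :: "nat \<Rightarrow> 'w \<Rightarrow> 'b::{real_inner, second_countable_topology}"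
  assumes inner_measurable: "\<And>n y. (\<lambda>\<omega>. X n \<omega> \<bullet> y) \<in> borel_measurable M" and s_in: "s \<in> S"
    and lim: "AE \<omega> in M. \<exists>l\<in>S. weakly_tendsto (\<lambda>n. X n \<omega>) l"
  obtains xs where "xs \<in> borel_measurable M" "xs \<in> space M \<rightarrow> S"
    "AE \<omega> in M. weakly_tendsto (\<lambda>n. X n \<omega>) (xs \<omega>)"
proof -
  obtain Z where null_set: "{\<omega> \<in> space M. \<not> (\<exists>l\<in>S. weakly_tendsto (\<lambda>n. X n \<omega>) l)} \<subseteq> Z"
    "emeasure M Z = 0" "Z \<in> sets M"
    using AE_E[OF lim] by blast
  then have "\<forall>\<omega>\<in>space M - Z. \<exists>l. l \<in> S \<and> weakly_tendsto (\<lambda>n. X n \<omega>) l"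
    by blast
  then obtain l where limit: "\<And>\<omega>. \<omega> \<in> space M - Z \<Longrightarrow> l \<omega> \<in> S"
    "\<And>\<omega>. \<omega> \<in> space M - Z \<Longrightarrow> weakly_tendsto (\<lambda>n. X n \<omega>) (l \<omega>)"
    by metis
  define xs where "xs \<omega> = (if \<omega> \<in> Z then s else l \<omega>)" for \<omega>
  show thesis
  proof (rule that)
    show "xs \<in> borel_measurable M"
    proof (rule borel_measurable_if_inner, rule borel_measurable_LIMSEQ_real)
      show "(\<lambda>\<omega>. if \<omega> \<in> Z then s \<bullet> y else X n \<omega> \<bullet> y) \<in> borel_measurable M" for n y
        using null_set(3) inner_measurable[of n y] by measurable
      show "(\<lambda>n. if \<omega> \<in> Z then s \<bullet> y else X n \<omega> \<bullet> y) \<longlonglongrightarrow> xs \<omega> \<bullet> y" if "\<omega> \<in> space M" for \<omega> y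
        using limit(2)[of \<omega>] that by (simp add: xs_def weakly_tendstoD)
    qed
    show "xs \<in> space M \<rightarrow> S"
      using limit(1) s_in by (simp add: xs_def)
    show "AE \<omega> in M. weakly_tendsto (\<lambda>n. X n \<omega>) (xs \<omega>)"
      by (rule AE_I[of _ _ Z]) (use limit(2) null_set in \<open>auto simp: xs_def\<close>)
  qed
qed

section \<open>Doob's convergence theorem for nonnegative supermartingales\<close>

text \<open>\<open>holding\<close> is the betting strategy that starts when \<open>y\<close> is below \<open>a\<close> and stops when it is
  above \<open>b\<close>; each completed round is an upcrossing and earns at least \<open>b - a\<close>.\<close>

primrec holding :: "real \<Rightarrow> real \<Rightarrow> (nat \<Rightarrow> real) \<Rightarrow> nat \<Rightarrow> bool" where
  "holding a b y 0 \<longleftrightarrow> y 0 < a"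
| "holding a b y (Suc n) \<longleftrightarrow> (if holding a b y n then y (Suc n) \<le> b else y (Suc n) < a)"

definition upcrossings :: "real \<Rightarrow> real \<Rightarrow> (nat \<Rightarrow> real) \<Rightarrow> nat \<Rightarrow> nat" where
  "upcrossings a b y n = (\<Sum>k<n. of_bool (holding a b y k \<and> \<not> holding a b y (Suc k)))"

lemma upcrossings_Suc:
  "upcrossings a b y (Suc n)
    = upcrossings a b y n + of_bool (holding a b y n \<and> \<not> holding a b y (Suc n))"
  by (simp add: upcrossings_def)

lemma incseq_upcrossings: "incseq (upcrossings a b y)"
  by (rule incseq_SucI) (simp add: upcrossings_Suc)

lemma upcrossings_le_gain:
  assumes nonneg: "\<And>n. y n \<ge> 0" and a_b: "0 < a" "a < b"
  shows "(b - a) * real (upcrossings a b y n)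
    \<le> a + (\<Sum>k<n. of_bool (holding a b y k) * (y (Suc k) - y k))"
proof -
  have "(b - a) * real (upcrossings a b y n) + of_bool (holding a b y n) * (y n - a)
      \<le> (\<Sum>k<n. of_bool (holding a b y k) * (y (Suc k) - y k))"
  proof (induction n)
    case 0
    then show ?case
      by (simp add: upcrossings_def)
  next
    case (Suc n)
    have "(b - a) * of_bool (holding a b y n \<and> \<not> holding a b y (Suc n))
        + of_bool (holding a b y (Suc n)) * (y (Suc n) - a)
        \<le> of_bool (holding a b y n) * (y n - a) + of_bool (holding a b y n) * (y (Suc n) - y n)"
      by auto
    with Suc show ?case
      by (simp add: upcrossings_Suc distrib_left)
  qed
  moreover have "- a \<le> of_bool (holding a b y n) * (y n - a)"
    using nonneg[of n] a_b by auto
  ultimately show ?thesis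
    by linarith
qed

lemma finite_upcrossing_times:
  assumes "\<And>n. upcrossings a b y n \<le> K"
  shows "finite {k. holding a b y k \<and> \<not> holding a b y (Suc k)}" (is "finite {k. ?P k}")
proof (rule ccontr)
  assume "\<not> ?thesis"
  then obtain A where many_upcrossings: "finite A" "card A = Suc K" "A \<subseteq> {k. ?P k}"
    using infinite_arbitrarily_large by blast
  then obtain n where before_n: "A \<subseteq> {..<n}"
    using finite_nat_iff_bounded by blast
  have "card A = (\<Sum>k\<in>A. of_bool (?P k))"
    using many_upcrossings(3) by (subst sum.cong[of A A _ "\<lambda>_. 1"]) auto
  also have "\<dots> \<le> upcrossings a b y n"
    unfolding upcrossings_def using before_n by (intro sum_mono2) auto
  finally show False
    using assms[of n] many_upcrossings(2) by simp
qed

lemma not_oscillating_if_upcrossings_bounded: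
  assumes "\<And>n. upcrossings a b y n \<le> K" and below: "\<exists>\<^sub>F n in sequentially. y n < a"
  shows "\<forall>\<^sub>F n in sequentially. y n \<le> b"
proof -
  obtain N where stay: "\<And>k. k \<ge> N \<Longrightarrow> holding a b y k \<Longrightarrow> holding a b y (Suc k)"
    using finite_upcrossing_times[OF assms(1)] unfolding finite_nat_iff_bounded
    by (auto simp: subset_eq) (metis leD)
  obtain m where low: "m > N" "y m < a"
    using below unfolding frequently_sequentially by (metis Suc_le_lessD)
  then obtain k where m_eq: "m = Suc k" "k \<ge> N"
    by (cases m) auto
  have hold: "holding a b y n" if "n \<ge> m" for n
    using that
  proof (induction n rule: dec_induct)
    case base
    show ?case
      using stay[OF m_eq(2)] low(2) m_eq(1) by (cases "holding a b y k") auto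
  next
    case (step n)
    then show ?case
      using stay[of n] low(1) by linarith
  qed
  show ?thesis
    unfolding eventually_sequentially
  proof (intro exI[of _ "Suc m"] allI impI)
    fix n assume "n \<ge> Suc m"
    then show "y n \<le> b"
      using hold[of n] hold[of "n - 1"] by (cases n) auto
  qed
qed

lemma frequently_less_if_liminf_less:
  fixes y :: "nat \<Rightarrow> real"
  assumes "liminf (\<lambda>n. ereal (y n)) < ereal a"
  shows "\<exists>\<^sub>F n in sequentially. y n < a"
proof (rule ccontr)
  assume "\<not> ?thesis"
  then have "ereal a \<le> liminf (\<lambda>n. ereal (y n))"
    by (intro Liminf_bounded) (simp add: not_frequently not_less)
  with assms show False
    by simp
qed

lemma convergent_if_upcrossings_bounded:
  fixes y :: "nat \<Rightarrow> real"
  assumes nonneg: "\<And>n. y n \<ge> 0" and not_PInfty: "\<not> filterlim y at_top sequentially"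
    and bounded: "\<And>a b. \<lbrakk>a \<in> \<rat>; b \<in> \<rat>; 0 < a; a < b\<rbrakk> \<Longrightarrow> \<exists>K. \<forall>n. upcrossings a b y n \<le> K"
  shows "convergent y"
proof -
  define l where "l = liminf (\<lambda>n. ereal (y n))"
  define u where "u = limsup (\<lambda>n. ereal (y n))"
  have "0 \<le> l"
    unfolding l_def by (rule Liminf_bounded) (use nonneg in auto)
  have "u \<le> l"
  proof (rule ccontr)
    assume "\<not> u \<le> l"
    then obtain a where a_between: "l < ereal (real_of_rat a)" "ereal (real_of_rat a) < u"
      using ereal_dense3 by (meson not_le)
    then obtain b where b_between: "ereal (real_of_rat a) < ereal (real_of_rat b)"
      "ereal (real_of_rat b) < u"
      using ereal_dense3 by blast
    have "0 < real_of_rat a"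
      using \<open>0 \<le> l\<close> a_between(1) by (metis ereal_less(2) le_less_trans)
    then obtain K where upcrossings_le: "\<And>n. upcrossings (real_of_rat a) (real_of_rat b) y n \<le> K"
      using bounded b_between(1) by (metis Rats_of_rat less_ereal.simps(1))
    from upcrossings_le frequently_less_if_liminf_less[OF a_between(1)[unfolded l_def]]
    have "\<forall>\<^sub>F n in sequentially. y n \<le> real_of_rat b"
      by (rule not_oscillating_if_upcrossings_bounded)
    then have "u \<le> ereal (real_of_rat b)"
      unfolding u_def by (intro Limsup_bounded) simp
    with b_between(2) show False
      by simp
  qed
  moreover have "l \<noteq> \<infinity>"
    using not_PInfty Liminf_PInfty[of sequentially "\<lambda>n. ereal (y n)"]
    by (simp add: l_def tendsto_PInfty_eq_at_top)
  then obtain c where "l = ereal c"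
    using \<open>0 \<le> l\<close> by (cases l) auto
  ultimately have "y \<longlonglongrightarrow> c"
    by (intro limsup_le_liminf_real) (auto simp: l_def u_def)
  then show ?thesis
    by (auto simp: convergent_def)
qed

locale nonneg_supermartingale = finite_measure M + filtration "space M" F
  for M :: "'w measure" and F :: "nat \<Rightarrow> 'w measure" +
  fixes Y :: "nat \<Rightarrow> 'w \<Rightarrow> real"
  assumes sets_F_subset: "\<And>n. sets (F n) \<subseteq> sets M"
    and adapted: "\<And>n. Y n \<in> borel_measurable (F n)"
    and integrable: "\<And>n. integrable M (Y n)"
    and nonneg: "\<And>n \<omega>. \<omega> \<in> space M \<Longrightarrow> Y n \<omega> \<ge> 0"
    and integral_Suc_le:
      "\<And>n A. A \<in> sets (F n) \<Longrightarrow> (LINT \<omega>:A|M. Y (Suc n) \<omega>) \<le> (LINT \<omega>:A|M. Y n \<omega>)"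
begin

lemma borel_measurable_Y [measurable]: "Y n \<in> borel_measurable M"
  using integrable by (rule borel_measurable_integrable)

lemma sets_holding: "{\<omega> \<in> space M. holding a b (\<lambda>n. Y n \<omega>) n} \<in> sets (F n)"
proof (induction n)
  case 0
  have [measurable]: "Y 0 \<in> borel_measurable (F 0)"
    by (rule adapted)
  have "{\<omega> \<in> space (F 0). Y 0 \<omega> < a} \<in> sets (F 0)"
    by measurable
  then show ?case
    by (simp add: space_F)
next
  case (Suc n)
  have [measurable]: "Y (Suc n) \<in> borel_measurable (F (Suc n))"
    by (rule adapted)
  have [measurable]: "{\<omega> \<in> space (F (Suc n)). holding a b (\<lambda>n. Y n \<omega>) n} \<in> sets (F (Suc n))"
    using Suc sets_F_mono[of n "Suc n"] by (auto simp: space_F)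
  have "{\<omega> \<in> space (F (Suc n)).
      if holding a b (\<lambda>n. Y n \<omega>) n then Y (Suc n) \<omega> \<le> b else Y (Suc n) \<omega> < a} \<in> sets (F (Suc n))"
    by measurable
  then show ?case
    by (simp add: space_F)
qed

lemma pred_holding [measurable]: "Measurable.pred M (\<lambda>\<omega>. holding a b (\<lambda>n. Y n \<omega>) n)"
  using subsetD[OF sets_F_subset sets_holding] by (simp add: Measurable.pred_def)

lemma borel_measurable_upcrossings [measurable]:
  "(\<lambda>\<omega>. real (upcrossings a b (\<lambda>n. Y n \<omega>) n)) \<in> borel_measurable M"
  unfolding upcrossings_def of_nat_sum of_nat_of_bool by measurable

lemma integral_gain_le_0:
  "(\<integral>\<omega>. of_bool (holding a b (\<lambda>n. Y n \<omega>) k) * (Y (Suc k) \<omega> - Y k \<omega>) \<partial>M) \<le> 0"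
proof -
  define A where "A = {\<omega> \<in> space M. holding a b (\<lambda>n. Y n \<omega>) k}"
  have A_in_sets: "A \<in> sets M"
    unfolding A_def by measurable
  have "(\<integral>\<omega>. of_bool (holding a b (\<lambda>n. Y n \<omega>) k) * (Y (Suc k) \<omega> - Y k \<omega>) \<partial>M)
      = (LINT \<omega>:A|M. Y (Suc k) \<omega> - Y k \<omega>)"
    unfolding set_lebesgue_integral_def A_def
    by (intro Bochner_Integration.integral_cong) (auto simp: indicator_def)
  also have "\<dots> = (LINT \<omega>:A|M. Y (Suc k) \<omega>) - (LINT \<omega>:A|M. Y k \<omega>)"
    using A_in_sets integrable by (intro set_integral_diff)
      (auto simp: set_integrable_def simp del: real_scaleR_def intro: integrable_mult_indicator)
  also have "\<dots> \<le> 0"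
    using integral_Suc_le[OF sets_holding] by (simp add: A_def)
  finally show ?thesis .
qed

lemma nn_integral_upcrossings_le:
  assumes a_b: "0 < a" "a < b"
  shows "(\<integral>\<^sup>+\<omega>. ennreal (real (upcrossings a b (\<lambda>n. Y n \<omega>) n)) \<partial>M)
    \<le> ennreal (a * measure M (space M) / (b - a))"
proof -
  define gain where
    "gain \<omega> = (\<Sum>k<n. of_bool (holding a b (\<lambda>n. Y n \<omega>) k) * (Y (Suc k) \<omega> - Y k \<omega>))" for \<omega>
  have integrable_gain:
    "integrable M (\<lambda>\<omega>. of_bool (holding a b (\<lambda>n. Y n \<omega>) k) * (Y (Suc k) \<omega> - Y k \<omega>))" for k
    by (rule Bochner_Integration.integrable_bound[of _ "\<lambda>\<omega>. Y (Suc k) \<omega> - Y k \<omega>"])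
      (auto intro: integrable)
  then have "integrable M gain"
    unfolding gain_def by (intro Bochner_Integration.integrable_sum)
  have upcrossings_le: "real (upcrossings a b (\<lambda>n. Y n \<omega>) n) \<le> (a + gain \<omega>) / (b - a)"
    if "\<omega> \<in> space M" for \<omega>
    using that upcrossings_le_gain[of "\<lambda>n. Y n \<omega>" a b n] nonneg a_b
    by (simp add: gain_def pos_le_divide_eq mult.commute)
  have "(\<integral>\<^sup>+\<omega>. ennreal (real (upcrossings a b (\<lambda>n. Y n \<omega>) n)) \<partial>M)
      \<le> (\<integral>\<^sup>+\<omega>. ennreal ((a + gain \<omega>) / (b - a)) \<partial>M)"
    by (intro nn_integral_mono ennreal_leI upcrossings_le)
  also have "\<dots> = ennreal (\<integral>\<omega>. (a + gain \<omega>) / (b - a) \<partial>M)"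
    using \<open>integrable M gain\<close> order_trans[OF _ upcrossings_le]
    by (intro nn_integral_eq_integral AE_I2) auto
  also have "(\<integral>\<omega>. (a + gain \<omega>) / (b - a) \<partial>M)
      = (a * measure M (space M) + (\<integral>\<omega>. gain \<omega> \<partial>M)) / (b - a)"
    using \<open>integrable M gain\<close> by (simp add: mult.commute)
  also have "(\<integral>\<omega>. gain \<omega> \<partial>M) \<le> 0"
    unfolding gain_def using integrable_gain integral_gain_le_0
    by (subst Bochner_Integration.integral_sum) (auto intro: sum_nonpos)
  finally show ?thesis
    using a_b by (simp add: ennreal_leI divide_right_mono)
qed

lemma AE_upcrossings_bounded:
  assumes a_b: "0 < a" "a < b"
  shows "AE \<omega> in M. \<exists>K. \<forall>n. upcrossings a b (\<lambda>n. Y n \<omega>) n \<le> K"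
proof -
  define U where "U n \<omega> = ennreal (real (upcrossings a b (\<lambda>n. Y n \<omega>) n))" for n \<omega>
  have [measurable]: "U n \<in> borel_measurable M" for n
    unfolding U_def by measurable
  have "incseq U"
    unfolding U_def using incseq_upcrossings by (auto simp: incseq_def le_fun_def)
  then have "(\<integral>\<^sup>+\<omega>. (SUP n. U n \<omega>) \<partial>M) = (SUP n. \<integral>\<^sup>+\<omega>. U n \<omega> \<partial>M)"
    by (intro nn_integral_monotone_convergence_SUP) auto
  also have "\<dots> \<le> ennreal (a * measure M (space M) / (b - a))"
    unfolding U_def by (intro SUP_least nn_integral_upcrossings_le a_b)
  finally have "(\<integral>\<^sup>+\<omega>. (SUP n. U n \<omega>) \<partial>M) \<noteq> \<infinity>"
    by (auto simp: top_unique)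
  then have "AE \<omega> in M. (SUP n. U n \<omega>) \<noteq> \<infinity>"
    by (intro nn_integral_PInf_AE) auto
  then show ?thesis
  proof eventually_elim
    case (elim \<omega>)
    then obtain c where SUP_eq: "(SUP n. U n \<omega>) = ennreal c" "c \<ge> 0"
      by (cases "SUP n. U n \<omega>") auto
    have "real (upcrossings a b (\<lambda>n. Y n \<omega>) n) \<le> c" for n
      using SUP_upper[of n UNIV "\<lambda>n. U n \<omega>"] SUP_eq by (simp add: U_def)
    then show ?case
      by (intro exI[of _ "nat \<lfloor>c\<rfloor>"]) (simp add: le_nat_floor)
  qed
qed

lemma integral_le_integral_0: "(\<integral>\<omega>. Y n \<omega> \<partial>M) \<le> (\<integral>\<omega>. Y 0 \<omega> \<partial>M)"
proof (induction n)
  case (Suc n)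
  have "(\<integral>\<omega>. Y (Suc n) \<omega> \<partial>M) \<le> (\<integral>\<omega>. Y n \<omega> \<partial>M)"
    using integral_Suc_le[OF sets.top[of "F n"]] integrable
    by (simp add: space_F set_integral_space)
  with Suc show ?case
    by simp
qed simp

lemma AE_not_tendsto_PInfty: "AE \<omega> in M. \<not> filterlim (\<lambda>n. Y n \<omega>) at_top sequentially"
proof -
  have "(\<integral>\<^sup>+\<omega>. liminf (\<lambda>n. ennreal (Y n \<omega>)) \<partial>M) \<le> liminf (\<lambda>n. \<integral>\<^sup>+\<omega>. ennreal (Y n \<omega>) \<partial>M)"
    by (rule nn_integral_liminf) measurable
  also have "\<dots> \<le> liminf (\<lambda>n. ennreal (\<integral>\<omega>. Y 0 \<omega> \<partial>M))"
    using integral_le_integral_0 nonneg integrable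
    by (intro Liminf_mono always_eventually allI) (simp add: nn_integral_eq_integral ennreal_leI)
  finally have "(\<integral>\<^sup>+\<omega>. liminf (\<lambda>n. ennreal (Y n \<omega>)) \<partial>M) \<noteq> \<infinity>"
    by (auto simp: Liminf_const top_unique)
  then have "AE \<omega> in M. liminf (\<lambda>n. ennreal (Y n \<omega>)) \<noteq> \<infinity>"
    by (intro nn_integral_PInf_AE) measurable
  then show ?thesis
  proof eventually_elim
    case (elim \<omega>)
    then show ?case
      using lim_imp_Liminf[OF trivial_limit_sequentially, of "\<lambda>n. ennreal (Y n \<omega>)" \<top>]
      by (auto simp: ennreal_tendsto_top_eq_at_top)
  qed
qed

theorem AE_convergent: "AE \<omega> in M. convergent (\<lambda>n. Y n \<omega>)"
proof -
  have "AE \<omega> in M. \<forall>a\<in>{a \<in> \<rat>. 0 < a}. \<forall>b\<in>{b \<in> \<rat>. a < b}. \<exists>K. \<forall>n. upcrossings a b (\<lambda>n. Y n \<omega>) n \<le> K"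
  proof (intro AE_ball_countable[THEN iffD2] ballI)
    show "countable {a \<in> \<rat>. (0::real) < a}" "countable {b \<in> \<rat>. a < b}" for a :: real
      by (rule countable_subset[OF _ countable_rat], auto)+
  qed (use AE_upcrossings_bounded in auto)
  then show ?thesis
    using AE_not_tendsto_PInfty AE_space
  proof eventually_elim
    case (elim \<omega>)
    then show ?case
      by (intro convergent_if_upcrossings_bounded) (auto intro: nonneg)
  qed
qed

end

section \<open>Recursions driven by independent copies of a random variable\<close>

lemma sum_mult_of_bool_eq_UNIV:
  fixes g :: "'e::finite \<Rightarrow> real"
  shows "(\<Sum>e\<in>UNIV. g e * of_bool (a = e)) = g a"
  by (simp add: of_bool_def if_distrib cong: if_cong)

lemma (in finite_measure) integrable_simple_function_compose:
  fixes g :: "'c \<Rightarrow> real"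
  assumes "simple_function M X"
  shows "integrable M (\<lambda>\<omega>. g (X \<omega>))"
  by (rule integrable_simple_function) (use simple_function_compose1[OF assms] in auto)

lemma AE_tendsto_0_if_summable_expectation:
  fixes Z :: "nat \<Rightarrow> 'w \<Rightarrow> real"
  assumes integrable_Z: "\<And>n. integrable M (Z n)"
    and nonneg: "\<And>n \<omega>. \<omega> \<in> space M \<Longrightarrow> Z n \<omega> \<ge> 0"
    and summable_Z: "summable (\<lambda>n. \<integral>\<omega>. Z n \<omega> \<partial>M)"
  shows "AE \<omega> in M. (\<lambda>n. Z n \<omega>) \<longlonglongrightarrow> 0"
proof -
  have [measurable]: "Z n \<in> borel_measurable M" for n
    using integrable_Z by (rule borel_measurable_integrable)
  have "(\<integral>\<^sup>+\<omega>. (\<Sum>n. ennreal (Z n \<omega>)) \<partial>M) = (\<Sum>n. \<integral>\<^sup>+\<omega>. ennreal (Z n \<omega>) \<partial>M)"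
    by (rule nn_integral_suminf) measurable
  also have "\<dots> = (\<Sum>n. ennreal (\<integral>\<omega>. Z n \<omega> \<partial>M))"
    using nonneg by (intro suminf_cong nn_integral_eq_integral integrable_Z) auto
  also have "\<dots> = ennreal (\<Sum>n. \<integral>\<omega>. Z n \<omega> \<partial>M)"
    using nonneg summable_Z by (intro suminf_ennreal2) (auto intro: integral_nonneg_AE)
  finally have "(\<integral>\<^sup>+\<omega>. (\<Sum>n. ennreal (Z n \<omega>)) \<partial>M) \<noteq> \<infinity>"
    by simp
  then have "AE \<omega> in M. (\<Sum>n. ennreal (Z n \<omega>)) \<noteq> \<infinity>"
    by (intro nn_integral_PInf_AE) measurable
  then show ?thesis
    using AE_space
  proof eventually_elim
    case (elim \<omega>)
    then have "summable (\<lambda>n. Z n \<omega>)"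
      using nonneg by (intro summable_suminf_not_top) auto
    then show ?case
      by (rule summable_LIMSEQ_zero)
  qed
qed

locale iid_recursion = prob_space M for M :: "'w measure" +
  fixes \<xi> :: "'w \<Rightarrow> 'e::finite" and \<xi>s :: "nat \<Rightarrow> 'w \<Rightarrow> 'e"
    and D :: "'s set" and step :: "'s \<Rightarrow> 'e \<Rightarrow> 's" and x0 :: 's and x :: "nat \<Rightarrow> 'w \<Rightarrow> 's"
  assumes measurable_input [measurable]: "\<xi> \<in> measurable M (count_space UNIV)"
    and indep: "indep_vars (\<lambda>_. count_space UNIV) \<xi>s UNIV"
    and copies: "\<And>n. distr M (count_space UNIV) (\<xi>s n) = distr M (count_space UNIV) \<xi>"
    and x0_in: "x0 \<in> D" and step_in: "\<And>s e. s \<in> D \<Longrightarrow> step s e \<in> D"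
    and x_0: "\<And>\<omega>. \<omega> \<in> space M \<Longrightarrow> x 0 \<omega> = x0"
    and x_Suc: "\<And>n \<omega>. \<omega> \<in> space M \<Longrightarrow> x (Suc n) \<omega> = step (x n \<omega>) (\<xi>s n \<omega>)"
begin

lemma x_in: "\<omega> \<in> space M \<Longrightarrow> x n \<omega> \<in> D"
  by (induction n) (auto simp: x_0 x_Suc x0_in step_in)

lemma measurable_inputs [measurable]: "\<xi>s n \<in> measurable M (count_space UNIV)"
  using indep by (auto simp: indep_vars_def)

definition input_events :: "nat \<Rightarrow> 'w set set" where
  "input_events k = {\<xi>s k -` A \<inter> space M |A. A \<in> sets (count_space UNIV)}"

definition past :: "nat \<Rightarrow> 'w measure" where
  "past n = sigma (space M) (\<Union>k<n. input_events k)"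

lemma space_past: "space (past n) = space M"
  by (simp add: past_def space_measure_of_conv)

lemma sets_past:
  "sets (past n) = sigma_sets (space M) (\<Union>k<n. input_events k)"
  unfolding past_def by (intro sets_measure_of) (auto simp: input_events_def)

lemma sets_past_mono: "m \<le> n \<Longrightarrow> sets (past m) \<subseteq> sets (past n)"
  unfolding sets_past by (intro sigma_sets_mono' UN_mono) auto

lemma sets_past_subset: "sets (past n) \<subseteq> sets M"
  unfolding sets_past
  by (intro sets.sigma_sets_subset)
    (auto simp: input_events_def intro: measurable_sets[OF measurable_inputs])

lemma simple_function_inputs:
  assumes "k < n"
  shows "simple_function (past n) (\<xi>s k)"
  unfolding simple_function_def space_past sets_past
  using assms by (auto simp: input_events_def intro!: sigma_sets.Basic)

lemma simple_function_past_x: "simple_function (past n) (x n)"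
proof (induction n)
  case 0
  have "simple_function (past 0) (\<lambda>_. x0)"
    by simp
  then show ?case
    by (subst simple_function_cong[of _ _ "\<lambda>_. x0"]) (auto simp: space_past x_0)
next
  case (Suc n)
  have "simple_function (past (Suc n)) (x n)"
    by (rule simple_function_subalgebra[OF Suc]) (simp_all add: sets_past_mono space_past)
  then have "simple_function (past (Suc n)) (\<lambda>\<omega>. step (x n \<omega>) (\<xi>s n \<omega>))"
    by (rule simple_function_compose2) (simp add: simple_function_inputs)
  then show ?case
    by (subst simple_function_cong[of _ _ "\<lambda>\<omega>. step (x n \<omega>) (\<xi>s n \<omega>)"])
      (auto simp: space_past x_Suc)
qed

lemma simple_function_x: "simple_function M (x n)"
  by (rule simple_function_subalgebra[OF simple_function_past_x sets_past_subset space_past])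

lemma integrable_x: "integrable M (\<lambda>\<omega>. (g (x n \<omega>) :: real))"
  using simple_function_x by (rule integrable_simple_function_compose)

lemma borel_measurable_x [measurable]: "(\<lambda>\<omega>. (g (x n \<omega>) :: real)) \<in> borel_measurable M"
  using integrable_x by (rule borel_measurable_integrable)

lemma integrable_input: "integrable M (\<lambda>\<omega>. (g (\<xi> \<omega>) :: real))"
  by (rule integrable_simple_function_compose)
    (simp add: simple_function_eq_measurable measurable_input)

lemma expectation_input:
  fixes g :: "'e \<Rightarrow> real"
  shows "expectation (\<lambda>\<omega>. g (\<xi> \<omega>)) = (\<Sum>e\<in>UNIV. g e * expectation (\<lambda>\<omega>. of_bool (\<xi> \<omega> = e)))"
proof -
  have "expectation (\<lambda>\<omega>. g (\<xi> \<omega>)) = expectation (\<lambda>\<omega>. \<Sum>e\<in>UNIV. g e * of_bool (\<xi> \<omega> = e))"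
    unfolding sum_mult_of_bool_eq_UNIV ..
  also have "\<dots> = (\<Sum>e\<in>UNIV. g e * expectation (\<lambda>\<omega>. of_bool (\<xi> \<omega> = e)))"
    by (subst Bochner_Integration.integral_sum) (auto intro: integrable_input)
  finally show ?thesis .
qed

lemma indep_past: "indep_set (sets (past n)) (sigma_sets (space M) (input_events n))"
proof -
  define I where "I = case_bool {..<n} {n}"
  have "indep_sets (\<lambda>b. sigma_sets (space M) (\<Union>k\<in>I b. input_events k)) UNIV"
  proof (rule indep_sets_collect_sigma)
    show "indep_sets input_events (\<Union>b\<in>UNIV. I b)"
      using indep unfolding indep_vars_def2 input_events_def by (auto intro: indep_sets_mono_index)
    show "Int_stable (input_events k)" for k
    proof (rule Int_stableI)
      fix a b assume "a \<in> input_events k" "b \<in> input_events k"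
      then obtain A B where "a = \<xi>s k -` A \<inter> space M" "b = \<xi>s k -` B \<inter> space M"
        by (auto simp: input_events_def)
      then show "a \<inter> b \<in> input_events k"
        unfolding input_events_def by (intro CollectI exI[of _ "A \<inter> B"]) auto
    qed
    show "disjoint_family_on I UNIV"
      by (auto simp: disjoint_family_on_def I_def split: bool.splits)
  qed
  then show ?thesis
    unfolding indep_set_def sets_past
    by (rule indep_sets_mono_sets) (auto simp: I_def split: bool.splits)
qed

lemma expectation_mult_input:
  fixes Z :: "'w \<Rightarrow> real" and k :: "'e \<Rightarrow> real"
  assumes Z_past: "Z \<in> borel_measurable (past n)" "integrable M Z"
  shows "expectation (\<lambda>\<omega>. Z \<omega> * k (\<xi>s n \<omega>)) = expectation Z * expectation (\<lambda>\<omega>. k (\<xi> \<omega>))"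
proof -
  have integrable_k: "integrable M (\<lambda>\<omega>. k (\<xi>s n \<omega>))"
    by (rule integrable_simple_function_compose) (simp add: simple_function_eq_measurable)
  have "indep_var borel Z borel (\<lambda>\<omega>. k (\<xi>s n \<omega>))"
    unfolding indep_var_eq
  proof (intro conjI)
    have "sigma_sets (space M) {Z -` A \<inter> space M |A. A \<in> sets borel} \<subseteq> sets (past n)"
      unfolding space_past[of n, symmetric]
      by (rule sets.sigma_sets_subset) (use measurable_sets[OF Z_past(1)] in auto)
    moreover have "sigma_sets (space M) {(\<lambda>\<omega>. k (\<xi>s n \<omega>)) -` A \<inter> space M |A. A \<in> sets borel}
        \<subseteq> sigma_sets (space M) (input_events n)"
    proof (rule sigma_sets_mono', clarify)
      fix A
      show "(\<lambda>\<omega>. k (\<xi>s n \<omega>)) -` A \<inter> space M \<in> input_events n"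
        unfolding input_events_def by (intro CollectI exI[of _ "k -` A"]) auto
    qed
    ultimately show "indep_set (sigma_sets (space M) {Z -` A \<inter> space M |A. A \<in> sets borel})
        (sigma_sets (space M) {(\<lambda>\<omega>. k (\<xi>s n \<omega>)) -` A \<inter> space M |A. A \<in> sets borel})"
      using indep_past[of n] unfolding indep_sets2_eq by (blast dest: subsetD)
  qed (use Z_past integrable_k in auto)
  then have "expectation (\<lambda>\<omega>. Z \<omega> * k (\<xi>s n \<omega>)) = expectation Z * expectation (\<lambda>\<omega>. k (\<xi>s n \<omega>))"
    using Z_past(2) integrable_k by (rule indep_var_lebesgue_integral)
  also have "expectation (\<lambda>\<omega>. k (\<xi>s n \<omega>)) = expectation (\<lambda>\<omega>. k (\<xi> \<omega>))"
    using integral_distr[OF measurable_inputs, of k n] integral_distr[OF measurable_input, of k]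
    by (simp add: copies)
  finally show ?thesis .
qed

lemma integral_step:
  fixes g :: "'s \<Rightarrow> real"
  assumes A_past: "A \<in> sets (past n)"
  shows "(LINT \<omega>:A|M. g (x (Suc n) \<omega>)) = (LINT \<omega>:A|M. expectation (\<lambda>\<omega>'. g (step (x n \<omega>) (\<xi> \<omega>'))))"
proof -
  have expectation_step: "expectation (\<lambda>\<omega>'. g (step s (\<xi> \<omega>')))
      = (\<Sum>e\<in>UNIV. g (step s e) * expectation (\<lambda>\<omega>'. of_bool (\<xi> \<omega>' = e)))" for s
    by (rule expectation_input)
  define Z where "Z e \<omega> = indicator A \<omega> * g (step (x n \<omega>) e)" for e \<omega>
  have simple_Z: "simple_function (past n) (Z e)" for e
    unfolding Z_def by (intro simple_function_mult simple_function_indicator A_past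
        simple_function_compose1[OF simple_function_past_x])
  then have Z_past: "Z e \<in> borel_measurable (past n)" for e
    by (rule borel_measurable_simple_function)
  have Z_int: "integrable M (Z e)" for e
    using simple_function_subalgebra[OF simple_Z sets_past_subset space_past]
    by (intro integrable_simple_function) auto
  then have [measurable]: "Z e \<in> borel_measurable M" for e
    by (rule borel_measurable_integrable)
  have "(LINT \<omega>:A|M. g (x (Suc n) \<omega>)) = expectation (\<lambda>\<omega>. \<Sum>e\<in>UNIV. Z e \<omega> * of_bool (\<xi>s n \<omega> = e))"
    unfolding set_lebesgue_integral_def sum_mult_of_bool_eq_UNIV
    by (intro Bochner_Integration.integral_cong) (auto simp: Z_def x_Suc)
  also have "\<dots> = (\<Sum>e\<in>UNIV. expectation (\<lambda>\<omega>. Z e \<omega> * of_bool (\<xi>s n \<omega> = e)))"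
  proof (rule Bochner_Integration.integral_sum)
    show "integrable M (\<lambda>\<omega>. Z e \<omega> * of_bool (\<xi>s n \<omega> = e))" for e
    proof (rule Bochner_Integration.integrable_bound[OF Z_int[of e]])
      have "(\<lambda>\<omega>. of_bool (\<xi>s n \<omega> = e) :: real) \<in> borel_measurable M"
        by (rule measurable_compose[OF measurable_inputs]) simp
      then show "(\<lambda>\<omega>. Z e \<omega> * of_bool (\<xi>s n \<omega> = e)) \<in> borel_measurable M"
        by measurable
    qed auto
  qed
  also have "\<dots> = (\<Sum>e\<in>UNIV. expectation (Z e) * expectation (\<lambda>\<omega>'. of_bool (\<xi> \<omega>' = e)))"
    by (intro sum.cong expectation_mult_input Z_past Z_int refl)
  also have "\<dots> = expectation (\<lambda>\<omega>. \<Sum>e\<in>UNIV. Z e \<omega> * expectation (\<lambda>\<omega>'. of_bool (\<xi> \<omega>' = e)))"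
    using Z_int by (subst Bochner_Integration.integral_sum) auto
  also have "\<dots> = (LINT \<omega>:A|M. expectation (\<lambda>\<omega>'. g (step (x n \<omega>) (\<xi> \<omega>'))))"
    unfolding set_lebesgue_integral_def real_scaleR_def
    by (simp only: expectation_step Z_def sum_distrib_left mult.assoc)
  finally show ?thesis .
qed

lemma expectation_Suc_le:
  fixes g k :: "'s \<Rightarrow> real"
  assumes "\<And>s. s \<in> D \<Longrightarrow> expectation (\<lambda>\<omega>. g (step s (\<xi> \<omega>))) \<le> k s"
  shows "expectation (\<lambda>\<omega>. g (x (Suc n) \<omega>)) \<le> expectation (\<lambda>\<omega>. k (x n \<omega>))"
proof -
  have "expectation (\<lambda>\<omega>. g (x (Suc n) \<omega>))
      = expectation (\<lambda>\<omega>. expectation (\<lambda>\<omega>'. g (step (x n \<omega>) (\<xi> \<omega>'))))"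
    using integral_step[OF sets.top, where g = g and n = n]
      integrable_x[of "\<lambda>s. expectation (\<lambda>\<omega>'. g (step s (\<xi> \<omega>')))" n] integrable_x[of g "Suc n"]
    by (simp add: space_past set_integral_space)
  also have "\<dots> \<le> expectation (\<lambda>\<omega>. k (x n \<omega>))"
    by (intro integral_mono integrable_x assms x_in)
  finally show ?thesis .
qed

lemma AE_convergent_lyapunov:
  fixes Y :: "'s \<Rightarrow> real"
  assumes nonneg: "\<And>s. s \<in> D \<Longrightarrow> Y s \<ge> 0"
    and decrease: "\<And>s. s \<in> D \<Longrightarrow> expectation (\<lambda>\<omega>. Y (step s (\<xi> \<omega>))) \<le> Y s"
  shows "AE \<omega> in M. convergent (\<lambda>n. Y (x n \<omega>))"
proof -
  interpret nonneg_supermartingale M past "\<lambda>n \<omega>. Y (x n \<omega>)"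
  proof
    fix n A
    assume A_past: "A \<in> sets (past n)"
    have "set_integrable M A (\<lambda>\<omega>. (g (x n \<omega>) :: real))" for g
      using A_past sets_past_subset integrable_x
      unfolding set_integrable_def by (intro integrable_mult_indicator) auto
    then show "(LINT \<omega>:A|M. Y (x (Suc n) \<omega>)) \<le> (LINT \<omega>:A|M. Y (x n \<omega>))"
      unfolding integral_step[OF A_past]
      using A_past sets_past_subset x_in sets.sets_into_space[OF A_past]
      by (intro set_integral_mono decrease) (auto simp: space_past)
  qed (auto simp: space_past intro: sets_past_mono[THEN subsetD] sets_past_subset[THEN subsetD]
      integrable_x nonneg x_in borel_measurable_simple_function
      simple_function_compose1[OF simple_function_past_x])
  show ?thesis
    by (rule AE_convergent)
qed

end

section \<open>Finite direct sums\<close>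

instance vec :: ("{metric_space, second_countable_topology}", finite) second_countable_topology
proof
  obtain A :: "'a set set" where basis_A: "countable A" "topological_basis A"
    using ex_countable_basis by auto
  define B :: "('a ^ 'b) set set" where "B = (\<lambda>U. {x. \<forall>i. x $ i \<in> U i}) ` (UNIV \<rightarrow>\<^sub>E A)"
  have "countable B"
    unfolding B_def using basis_A(1) by (intro countable_image countable_PiE) auto
  moreover have "topological_basis B"
  proof (rule topological_basisI)
    fix U assume "U \<in> B"
    then show "open U"
      using topological_basis_open[OF basis_A(2)] by (auto simp: B_def intro!: open_vector_box)
  next
    fix U and x :: "'a ^ 'b" assume "open U" "x \<in> U"
    then obtain Q where box_Q: "\<And>i. open (Q i) \<and> x $ i \<in> Q i" "\<And>y. (\<forall>i. y $ i \<in> Q i) \<Longrightarrow> y \<in> U"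
      unfolding open_vec_def by metis
    have "\<forall>i. \<exists>R. R \<in> A \<and> x $ i \<in> R \<and> R \<subseteq> Q i"
      using topological_basisE[OF basis_A(2)] box_Q(1) by metis
    then obtain R where box_R: "\<And>i. R i \<in> A \<and> x $ i \<in> R i \<and> R i \<subseteq> Q i"
      by metis
    then have "{y. \<forall>i. y $ i \<in> R i} \<subseteq> U"
      using box_Q(2) by blast
    with box_R show "\<exists>B'\<in>B. x \<in> B' \<and> B' \<subseteq> U"
      unfolding B_def by (intro bexI[of _ "{x. \<forall>i. x $ i \<in> R i}"]) auto
  qed
  ultimately show "\<exists>B::('a ^ 'b) set set. countable B \<and> open = generate_topology B"
    using topological_basis_imp_subbasis by blast
qed

lemma subspace_direct_sum: "(\<And>i. subspace (V i)) \<Longrightarrow> subspace (direct_sum V)"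
  by (auto simp: subspace_def direct_sum_def)

lemma closed_direct_sum:
  assumes "\<And>i. closed (V i)"
  shows "closed (direct_sum V)"
proof -
  have "direct_sum V = (\<Inter>i. (\<lambda>x. x $ i) -` V i)"
    by (auto simp: direct_sum_def)
  then show ?thesis
    by (simp only:) (intro closed_INT ballI closed_vimage_vec_nth assms)
qed

lemma closed_proper_convex_on_separable_sum:
  fixes h :: "'m::finite \<Rightarrow> 'a::real_normed_vector \<Rightarrow> ereal"
  assumes cpc: "\<And>i. closed_proper_convex_on (V i) (h i)"
  shows "closed_proper_convex_on (direct_sum V) (separable_sum h)"
  unfolding closed_proper_convex_on_def
proof (intro conjI)
  have closed_convex_V: "closed (V i)" "convex (V i)" and h_lsc: "lsc_on (V i) (h i)"
    and h_convex: "ereal_convex_on (V i) (h i)" and h_proper: "proper_on (V i) (h i)" for i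
    using cpc[of i] by (auto simp: closed_proper_convex_on_def ereal_convex_on_def)
  have not_MInfty: "h i (x $ i) \<noteq> -\<infinity>" if "x \<in> direct_sum V" for i x
    using h_proper[of i] that by (auto simp: proper_on_def direct_sum_def)
  show "closed (direct_sum V)"
    by (rule closed_direct_sum[OF closed_convex_V(1)])
  have "convex (direct_sum V)"
    using closed_convex_V(2) by (auto simp: convex_def direct_sum_def)
  then show "ereal_convex_on (direct_sum V) (separable_sum h)"
    unfolding separable_sum_def
    by (intro ereal_convex_on_sum ereal_convex_on_compose_linear[OF h_convex] finite
        bounded_linear.linear[OF bounded_linear_vec_nth]) (auto simp: direct_sum_def)
  show "lsc_on (direct_sum V) (separable_sum h)"
    unfolding separable_sum_def using not_MInfty
    by (intro lsc_on_sum lsc_on_compose[OF h_lsc] finite continuous_intros)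
      (auto simp: direct_sum_def)
  obtain y where "\<And>i. y i \<in> V i" "\<And>i. h i (y i) \<noteq> \<infinity>"
    using h_proper unfolding proper_on_def by metis
  then have "(\<chi> i. y i) \<in> direct_sum V" "separable_sum h (\<chi> i. y i) \<noteq> \<infinity>"
    by (auto simp: direct_sum_def separable_sum_def sum_Pinfty)
  moreover have "separable_sum h x \<noteq> -\<infinity>" if "x \<in> direct_sum V" for x
    unfolding separable_sum_def using not_MInfty[OF that] by (rule sum_ereal_not_MInfty)
  ultimately show "proper_on (direct_sum V) (separable_sum h)"
    by (auto simp: proper_on_def)
qed

lemma closed_proper_convex_on_add_real:
  assumes convex_continuous: "convex_on S g" "continuous_on S g"
    and cpc: "closed_proper_convex_on S \<phi>"
  shows "closed_proper_convex_on S (\<lambda>x. ereal (g x) + \<phi> x)"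
proof -
  have "lsc_on S (\<lambda>x. ereal (g x) + \<phi> x)"
    using cpc by (intro lsc_on_add lsc_on_continuous_on convex_continuous(2))
      (auto simp: closed_proper_convex_on_def proper_on_def)
  moreover have "ereal_convex_on S (\<lambda>x. ereal (g x) + \<phi> x)"
    using cpc by (intro ereal_convex_on_add ereal_convex_on_real convex_continuous(1))
      (simp add: closed_proper_convex_on_def)
  ultimately show ?thesis
    using cpc by (auto simp: closed_proper_convex_on_def proper_on_def)
qed

definition rescale :: "('m::finite \<Rightarrow> real) \<Rightarrow> 'a::real_vector ^ 'm \<Rightarrow> 'a ^ 'm" where
  "rescale w x = (\<chi> i. w i *\<^sub>R (x $ i))"

lemma rescale_diff: "rescale w (x - y) = rescale w x - rescale w y"
  by (simp add: rescale_def vec_eq_iff scaleR_diff_right)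

lemma surj_rescale:
  assumes "\<And>i. w i \<noteq> 0"
  obtains y where "x = rescale w y"
  using that[of "rescale (\<lambda>i. inverse (w i)) x"] assms by (simp add: rescale_def vec_eq_iff)

lemma weakly_tendsto_rescale_iff:
  fixes X :: "nat \<Rightarrow> 'a::real_inner ^ 'm::finite"
  assumes "\<And>i. w i \<noteq> 0"
  shows "weakly_tendsto (\<lambda>n. rescale w (X n)) (rescale w l) \<longleftrightarrow> weakly_tendsto X l"
proof -
  have adjoint: "rescale w x \<bullet> y = x \<bullet> rescale w y" for x y :: "'a ^ 'm"
    by (simp add: rescale_def inner_vec_def)
  show ?thesis
  proof
    assume lim: "weakly_tendsto (\<lambda>n. rescale w (X n)) (rescale w l)"
    show "weakly_tendsto X l"
      unfolding weakly_tendsto_on_def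
    proof
      fix y :: "'a ^ 'm"
      obtain z where "y = rescale w z"
        by (rule surj_rescale[OF assms])
      then show "(\<lambda>n. X n \<bullet> y) \<longlonglongrightarrow> l \<bullet> y"
        using weakly_tendstoD[OF lim, of z] by (simp add: adjoint)
    qed
  qed (simp add: weakly_tendsto_on_def adjoint)
qed

lemma norm_W_sq:
  assumes "\<And>i. \<gamma> i > 0" "\<And>i. p i > 0"
  shows "(norm_W \<gamma> p x)\<^sup>2 = (\<Sum>i\<in>UNIV. 1 / (\<gamma> i * p i) * (norm (x $ i))\<^sup>2)"
  unfolding norm_W_def using assms by (simp add: sum_nonneg less_imp_le)

lemma norm_W_eq_norm_rescale:
  assumes "\<And>i. \<gamma> i > 0" "\<And>i. p i > 0"
  shows "norm_W \<gamma> p x = norm (rescale (\<lambda>i. 1 / sqrt (\<gamma> i * p i)) x)"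
  unfolding norm_W_def norm_vec_def L2_set_def rescale_def
  using assms by (simp add: power_mult_distrib power_divide less_imp_le)

lemma AE_opial_norm_W:
  fixes X :: "nat \<Rightarrow> 'w \<Rightarrow> 'a::{real_inner, complete_space, second_countable_topology} ^ 'm::finite"
  assumes pos: "\<And>i. \<gamma> i > 0" "\<And>i. p i > 0" and "S \<noteq> {}"
    and conv: "\<And>z. z \<in> S \<Longrightarrow> AE \<omega> in M. convergent (\<lambda>n. norm_W \<gamma> p (X n \<omega> - z))"
    and cluster: "AE \<omega> in M. \<forall>r l. strict_mono r \<longrightarrow> weakly_tendsto ((\<lambda>n. X n \<omega>) \<circ> r) l \<longrightarrow> l \<in> S"
  shows "AE \<omega> in M. \<exists>l\<in>S. weakly_tendsto (\<lambda>n. X n \<omega>) l"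
proof -
  define w where "w i = 1 / sqrt (\<gamma> i * p i)" for i
  have norm_eq: "norm_W \<gamma> p y = norm (rescale w y)" for y :: "'a ^ 'm"
    unfolding w_def by (rule norm_W_eq_norm_rescale[OF pos])
  have w_nonzero: "w i \<noteq> 0" for i
    using pos[of i] by (simp add: w_def)
  have "AE \<omega> in M. \<exists>l\<in>rescale w ` S. weakly_tendsto (\<lambda>n. rescale w (X n \<omega>)) l"
  proof (rule AE_opial)
    show "AE \<omega> in M. convergent (\<lambda>n. norm (rescale w (X n \<omega>) - z))" if "z \<in> rescale w ` S" for z
      using conv that by (auto simp: norm_eq rescale_diff)
    show "AE \<omega> in M. \<forall>r l. strict_mono r
        \<longrightarrow> weakly_tendsto ((\<lambda>n. rescale w (X n \<omega>)) \<circ> r) l \<longrightarrow> l \<in> rescale w ` S"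
      using cluster
    proof eventually_elim
      case (elim \<omega>)
      show ?case
      proof (intro allI impI)
        fix r :: "nat \<Rightarrow> nat" and l
        assume subseq: "strict_mono r" "weakly_tendsto ((\<lambda>n. rescale w (X n \<omega>)) \<circ> r) l"
        obtain k where l_eq: "l = rescale w k"
          by (rule surj_rescale[OF w_nonzero])
        have "weakly_tendsto ((\<lambda>n. X n \<omega>) \<circ> r) k"
          using subseq(2) weakly_tendsto_rescale_iff[of w "(\<lambda>n. X n \<omega>) \<circ> r", OF w_nonzero]
          by (simp add: l_eq o_def)
        then show "l \<in> rescale w ` S"
          using elim subseq(1) l_eq by blast
      qed
    qed
  qed (use \<open>S \<noteq> {}\<close> in simp)
  then show ?thesis
    by eventually_elim (auto simp: weakly_tendsto_rescale_iff[of w, OF w_nonzero])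
qed

lemma le_dist_W_sq:
  assumes "S \<noteq> {}" and le_norm_W: "\<And>z. z \<in> S \<Longrightarrow> k \<le> (norm_W \<gamma> p (x - z))\<^sup>2"
    and pos: "\<And>i. \<gamma> i > 0" "\<And>i. p i > 0"
  shows "k \<le> (dist_W \<gamma> p x S)\<^sup>2"
proof (cases "k \<le> 0")
  case True
  then show ?thesis
    by (rule order_trans) simp
next
  case False
  have "sqrt k \<le> dist_W \<gamma> p x S"
    unfolding dist_W_def using assms(1) le_norm_W
    by (intro cINF_greatest real_le_lsqrt) (auto simp: norm_W_eq_norm_rescale[OF pos])
  then have "(sqrt k)\<^sup>2 \<le> (dist_W \<gamma> p x S)\<^sup>2"
    using False by (intro power_mono) auto
  with False show ?thesis
    by simp
qed

section \<open>One step of the block proximal gradient method\<close>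

lemma le_max_inverse_mult:
  fixes a b \<delta> :: real
  assumes "0 \<le> b" "b \<le> a" "\<delta> < 2"
  shows "a - b / 2 \<le> max 1 (1 / (2 - \<delta>)) * (a - \<delta> * b / 2)"
proof -
  have "\<delta> * b \<le> 2 * b"
    using assms by (intro mult_right_mono) auto
  then have nonneg: "0 \<le> a - \<delta> * b / 2"
    using assms(2) by linarith
  show ?thesis
  proof (cases "\<delta> \<le> 1")
    case True
    then have "a - b / 2 \<le> 1 * (a - \<delta> * b / 2)"
      using assms(1) mult_right_mono[of \<delta> 1 b] by simp
    also have "\<dots> \<le> max 1 (1 / (2 - \<delta>)) * (a - \<delta> * b / 2)"
      using nonneg by (intro mult_right_mono) auto
    finally show ?thesis .
  next
    case False
    then have "0 \<le> (\<delta> - 1) * (a - b)"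
      using assms(2) by simp
    then have "(2 - \<delta>) * (a - b / 2) \<le> a - \<delta> * b / 2"
      by (simp add: field_simps)
    then have "a - b / 2 \<le> 1 / (2 - \<delta>) * (a - \<delta> * b / 2)"
      using assms(3) by (simp add: pos_le_divide_eq mult.commute)
    also have "\<dots> \<le> max 1 (1 / (2 - \<delta>)) * (a - \<delta> * b / 2)"
      using nonneg by (intro mult_right_mono) auto
    finally show ?thesis .
  qed
qed

locale block_prox_gradient = prob_space M for M :: "'w measure" +
  fixes eps :: "'w \<Rightarrow> 'm::finite \<Rightarrow> bool"
    and V :: "'m \<Rightarrow> 'a::{real_inner, complete_space, second_countable_topology} set"
    and f :: "'a ^ 'm \<Rightarrow> real" and h :: "'m \<Rightarrow> 'a \<Rightarrow> ereal" and p \<nu> \<gamma> :: "'m \<Rightarrow> real"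
  assumes eps_measurable: "eps \<in> measurable M (count_space UNIV)"
    and V_subspace: "\<And>i. subspace (V i)"
    and V_closed: "\<And>i. closed (V i)"
    and f_convex: "convex_on (direct_sum V) f"
    and f_diff: "\<And>y. y \<in> direct_sum V \<Longrightarrow> f differentiable (at y within direct_sum V)"
    and h_proper: "\<And>i. proper_on (V i) (h i)"
    and h_convex: "\<And>i. ereal_convex_on (V i) (h i)"
    and h_lsc: "\<And>i. lsc_on (V i) (h i)"
    and p_def: "\<And>i. p i = measure M {\<omega> \<in> space M. eps \<omega> i}"
    and p_pos: "\<And>i. p i > 0"
    and \<nu>_pos: "\<And>i. \<nu> i > 0"
    and smooth: "\<And>y v. y \<in> direct_sum V \<Longrightarrow> v \<in> direct_sum V \<Longrightarrow>
      (\<integral>\<omega>. f (y + eps \<omega> \<odot> v) \<partial>M)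
        \<le> f y + (\<integral>\<omega>. gradient_on (direct_sum V) f y \<bullet> (eps \<omega> \<odot> v) \<partial>M)
          + 1 / 2 * (\<Sum>i\<in>UNIV. p i * \<nu> i * (norm (v $ i))\<^sup>2)"
    and \<gamma>_pos: "\<And>i. 0 < \<gamma> i"
    and \<gamma>_less: "\<And>i. \<gamma> i < 2 / \<nu> i"
begin

abbreviation H :: "('a ^ 'm) set" where
  "H \<equiv> direct_sum V"

abbreviation grad :: "'a ^ 'm \<Rightarrow> 'a ^ 'm" where
  "grad \<equiv> gradient_on H f"

definition F :: "'a ^ 'm \<Rightarrow> ereal" where
  "F x = ereal (f x) + separable_sum h x"

definition dom_F :: "('a ^ 'm) set" where
  "dom_F = {x \<in> H. F x < \<infinity>}"

definition h_real :: "'m \<Rightarrow> 'a \<Rightarrow> real" where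
  "h_real i z = real_of_ereal (h i z)"

definition F_real :: "'a ^ 'm \<Rightarrow> real" where
  "F_real x = f x + (\<Sum>i\<in>UNIV. h_real i (x $ i))"

definition forward_backward :: "'a ^ 'm \<Rightarrow> 'a ^ 'm" ("T") where
  "T x = (\<chi> i. prox_on (V i) (\<lambda>z. ereal (\<gamma> i) * h i z) (x $ i - \<gamma> i *\<^sub>R (grad x $ i)))"

definition block_step :: "'a ^ 'm \<Rightarrow> ('m \<Rightarrow> bool) \<Rightarrow> 'a ^ 'm" where
  "block_step x e = x + e \<odot> (T x - x)"

definition \<delta> :: real where
  "\<delta> = Max (range (\<lambda>i. \<gamma> i * \<nu> i))"

definition p_min :: real where
  "p_min = Min (range p)"

definition rate_const :: real where
  "rate_const = max 1 (1 / (2 - \<delta>)) / p_min"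

lemma H_subspace: "subspace H" and H_closed: "closed H"
  by (rule subspace_direct_sum[OF V_subspace], rule closed_direct_sum[OF V_closed])

lemma in_H_nth: "x \<in> H \<Longrightarrow> x $ i \<in> V i"
  by (simp add: direct_sum_def)

lemma closed_proper_convex_h: "closed_proper_convex_on (V i) (h i)"
  by (simp add: closed_proper_convex_on_def V_closed h_proper h_convex h_lsc)

lemma closed_proper_convex_F: "closed_proper_convex_on H F"
proof -
  have "continuous_on H f"
    using f_diff differentiable_imp_continuous_within
    by (auto simp: continuous_on_eq_continuous_within)
  then show ?thesis
    unfolding F_def[abs_def]
    by (intro closed_proper_convex_on_add_real f_convex closed_proper_convex_on_separable_sum
        closed_proper_convex_h)
qed

lemma h_eq_h_real: "z \<in> V i \<Longrightarrow> h i z < \<infinity> \<Longrightarrow> h i z = ereal (h_real i z)"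
  using h_proper[of i] by (cases "h i z") (auto simp: h_real_def proper_on_def)

lemma dom_F_iff: "x \<in> dom_F \<longleftrightarrow> x \<in> H \<and> (\<forall>i. h i (x $ i) < \<infinity>)"
  by (auto simp: dom_F_def F_def separable_sum_def sum_Pinfty)

lemma dom_F_in_H: "x \<in> dom_F \<Longrightarrow> x \<in> H"
  by (simp add: dom_F_iff)

lemma h_dom_F: "x \<in> dom_F \<Longrightarrow> h i (x $ i) = ereal (h_real i (x $ i))"
  by (simp add: dom_F_iff in_H_nth h_eq_h_real)

lemma F_eq_F_real: "x \<in> dom_F \<Longrightarrow> F x = ereal (F_real x)"
  by (simp add: F_def F_real_def separable_sum_def h_dom_F)

lemma closed_proper_convex_scaled_h: "closed_proper_convex_on (V i) (\<lambda>z. ereal (\<gamma> i) * h i z)"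
  by (rule closed_proper_convex_on_cmult[OF closed_proper_convex_h \<gamma>_pos])

lemma
  assumes "x \<in> H"
  shows T_in_H: "T x \<in> H" and h_T: "h i (T x $ i) = ereal (h_real i (T x $ i))"
proof -
  have T_in_V: "T x $ i \<in> V i" for i
    unfolding forward_backward_def
    using prox_on_minimizes(1)[OF closed_proper_convex_scaled_h] by simp
  then show "T x \<in> H"
    by (simp add: direct_sum_def)
  have "\<bar>ereal (\<gamma> i) * h i (T x $ i)\<bar> \<noteq> \<infinity>"
    unfolding forward_backward_def
    using prox_on_finite[OF closed_proper_convex_scaled_h] by simp
  then have "h i (T x $ i) < \<infinity>"
    using \<gamma>_pos[of i] by (cases "h i (T x $ i)") auto
  with T_in_V show "h i (T x $ i) = ereal (h_real i (T x $ i))"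
    by (rule h_eq_h_real)
qed

lemma T_variational:
  assumes x_in: "x \<in> H" and z_dom: "z \<in> V i" "h i z < \<infinity>"
  shows "h_real i (T x $ i)
    \<le> h_real i z + (x $ i - T x $ i) \<bullet> (T x $ i - z) / \<gamma> i + grad x $ i \<bullet> (z - T x $ i)"
proof -
  define t where "t = T x $ i"
  have "ereal (\<gamma> i) * h i t + ereal ((x $ i - \<gamma> i *\<^sub>R (grad x $ i) - t) \<bullet> (z - t))
      \<le> ereal (\<gamma> i) * h i z"
    by (rule prox_on_variational[OF closed_proper_convex_scaled_h])
      (simp_all add: t_def forward_backward_def z_dom(1))
  then have "\<gamma> i * h_real i t + (x $ i - \<gamma> i *\<^sub>R (grad x $ i) - t) \<bullet> (z - t) \<le> \<gamma> i * h_real i z"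
    using h_T[OF x_in, of i] h_eq_h_real[OF z_dom] by (simp add: t_def)
  moreover have "(x $ i - \<gamma> i *\<^sub>R (grad x $ i) - t) \<bullet> (z - t)
      = - ((x $ i - t) \<bullet> (t - z)) - \<gamma> i * (grad x $ i \<bullet> (z - t))"
    by (simp add: inner_diff_left inner_diff_right algebra_simps)
  ultimately have "\<gamma> i * h_real i t
      \<le> \<gamma> i * (h_real i z + (x $ i - t) \<bullet> (t - z) / \<gamma> i + grad x $ i \<bullet> (z - t))"
    using \<gamma>_pos[of i] by (simp add: distrib_left)
  then show ?thesis
    using \<gamma>_pos[of i] by (simp add: t_def)
qed

lemma block_step_nth: "block_step x e $ i = (if e i then T x $ i else x $ i)"
  by (simp add: block_step_def mask_def)

lemma block_step_in_dom_F:
  assumes "x \<in> dom_F"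
  shows "block_step x e \<in> dom_F"
proof -
  have x_in_H: "x \<in> H"
    using assms by (rule dom_F_in_H)
  have "h i (T x $ i) < \<infinity>" for i
    using h_T[OF x_in_H] by simp
  then show ?thesis
    using assms in_H_nth[OF T_in_H[OF x_in_H]]
    by (auto simp: dom_F_iff direct_sum_def block_step_nth)
qed

lemma integrable_eps: "integrable M (\<lambda>\<omega>. (g (eps \<omega>) :: real))"
  by (rule integrable_simple_function_compose[where X = eps and g = g])
    (simp add: simple_function_eq_measurable eps_measurable)

lemma expectation_of_bool_eps: "expectation (\<lambda>\<omega>. of_bool (eps \<omega> i)) = p i"
proof -
  have [measurable]: "{\<omega> \<in> space M. eps \<omega> i} \<in> sets M"
    using measurable_sets[OF eps_measurable, of "{e. e i}"]
    by (simp add: vimage_def Int_def conj_commute)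
  have "p i = expectation (\<lambda>\<omega>. indicator {\<omega> \<in> space M. eps \<omega> i} \<omega>)"
    by (simp add: p_def)
  also have "\<dots> = expectation (\<lambda>\<omega>. of_bool (eps \<omega> i))"
    by (intro Bochner_Integration.integral_cong) (auto simp: indicator_def)
  finally show ?thesis
    by simp
qed

lemma expectation_blockwise:
  "expectation (\<lambda>\<omega>. \<Sum>i\<in>UNIV. if eps \<omega> i then a i else b i) = (\<Sum>i\<in>UNIV. b i + p i * (a i - b i))"
proof -
  have expectation_block:
    "expectation (\<lambda>\<omega>. if eps \<omega> i then a i else b i) = b i + p i * (a i - b i)" for i
  proof -
    have "expectation (\<lambda>\<omega>. if eps \<omega> i then a i else b i)
        = expectation (\<lambda>\<omega>. b i + of_bool (eps \<omega> i) * (a i - b i))"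
      by (intro Bochner_Integration.integral_cong) auto
    also have "\<dots> = b i + p i * (a i - b i)"
      using integrable_eps[of "\<lambda>e. of_bool (e i)"] by (simp add: prob_space expectation_of_bool_eps)
    finally show ?thesis .
  qed
  have "expectation (\<lambda>\<omega>. \<Sum>i\<in>UNIV. if eps \<omega> i then a i else b i)
      = (\<Sum>i\<in>UNIV. expectation (\<lambda>\<omega>. if eps \<omega> i then a i else b i))"
    by (intro Bochner_Integration.integral_sum integrable_eps)
  then show ?thesis
    by (simp only: expectation_block)
qed

lemma expectation_f_masked_le:
  assumes "y \<in> H" "v \<in> H"
  shows "expectation (\<lambda>\<omega>. f (y + eps \<omega> \<odot> v))
    \<le> f y + (\<Sum>i\<in>UNIV. p i * (grad y $ i \<bullet> v $ i)) + 1 / 2 * (\<Sum>i\<in>UNIV. p i * \<nu> i * (norm (v $ i))\<^sup>2)"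
proof -
  have "grad y \<bullet> (e \<odot> v) = (\<Sum>i\<in>UNIV. if e i then grad y $ i \<bullet> v $ i else 0)" for e
    unfolding inner_vec_def mask_def by (intro sum.cong) auto
  then show ?thesis
    using smooth[OF assms] by (simp add: expectation_blockwise)
qed

definition model_decrease :: "'a ^ 'm \<Rightarrow> 'm \<Rightarrow> real" where
  "model_decrease x i = h_real i (x $ i) - h_real i (T x $ i) - grad x $ i \<bullet> (T x $ i - x $ i)"

definition residual :: "'a ^ 'm \<Rightarrow> 'm \<Rightarrow> real" where
  "residual x i = (norm (T x $ i - x $ i))\<^sup>2 / \<gamma> i"

lemma residual_nonneg: "residual x i \<ge> 0"
  using \<gamma>_pos[of i] by (simp add: residual_def)

lemma residual_le_model_decrease:
  assumes x_dom: "x \<in> dom_F"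
  shows "residual x i \<le> model_decrease x i"
proof -
  have "h_real i (T x $ i) \<le> h_real i (x $ i)
      + (x $ i - T x $ i) \<bullet> (T x $ i - x $ i) / \<gamma> i + grad x $ i \<bullet> (x $ i - T x $ i)"
    using x_dom by (intro T_variational) (auto simp: dom_F_iff in_H_nth)
  moreover have "(x $ i - T x $ i) \<bullet> (T x $ i - x $ i) = - (norm (T x $ i - x $ i))\<^sup>2"
    by (simp add: power2_norm_eq_inner inner_diff_left inner_diff_right)
  moreover have "grad x $ i \<bullet> (x $ i - T x $ i) = - (grad x $ i \<bullet> (T x $ i - x $ i))"
    by (simp add: inner_diff_right)
  ultimately show ?thesis
    by (simp add: model_decrease_def residual_def)
qed

lemma expectation_F_step_le_model:
  assumes x_dom: "x \<in> dom_F"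
  shows "expectation (\<lambda>\<omega>. F_real (block_step x (eps \<omega>)))
    \<le> F_real x - (\<Sum>i\<in>UNIV. p i * (model_decrease x i - \<gamma> i * \<nu> i * residual x i / 2))"
proof -
  define d where "d = T x - x"
  have x_in_H: "x \<in> H" and d_in_H: "d \<in> H"
    using dom_F_in_H[OF x_dom] T_in_H subspace_diff[OF H_subspace] by (auto simp: d_def)
  have "F_real (block_step x e) = f (x + e \<odot> d)
      + (\<Sum>i\<in>UNIV. if e i then h_real i (T x $ i) else h_real i (x $ i))" for e
    unfolding F_real_def block_step_nth by (simp add: block_step_def d_def if_distrib)
  then have "expectation (\<lambda>\<omega>. F_real (block_step x (eps \<omega>))) = expectation (\<lambda>\<omega>. f (x + eps \<omega> \<odot> d))
      + (\<Sum>i\<in>UNIV. h_real i (x $ i) + p i * (h_real i (T x $ i) - h_real i (x $ i)))"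
    unfolding expectation_blockwise[symmetric]
    by (simp only:) (intro Bochner_Integration.integral_add integrable_eps)
  also have "\<dots> \<le> f x + (\<Sum>i\<in>UNIV. p i * (grad x $ i \<bullet> d $ i))
      + 1 / 2 * (\<Sum>i\<in>UNIV. p i * \<nu> i * (norm (d $ i))\<^sup>2)
      + (\<Sum>i\<in>UNIV. h_real i (x $ i) + p i * (h_real i (T x $ i) - h_real i (x $ i)))"
    using expectation_f_masked_le[OF x_in_H d_in_H] by simp
  also have "\<dots> = f x + (\<Sum>i\<in>UNIV. p i * (grad x $ i \<bullet> d $ i) + 1 / 2 * (p i * \<nu> i * (norm (d $ i))\<^sup>2)
      + (h_real i (x $ i) + p i * (h_real i (T x $ i) - h_real i (x $ i))))"
    by (simp add: sum.distrib sum_distrib_left)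
  also have "\<dots> = f x
      + (\<Sum>i\<in>UNIV. h_real i (x $ i) - p i * (model_decrease x i - \<gamma> i * \<nu> i * residual x i / 2))"
    using \<gamma>_pos by (intro arg_cong2[where f = "(+)"] sum.cong refl)
      (auto simp: model_decrease_def residual_def d_def algebra_simps less_imp_neq[symmetric])
  also have "\<dots> = F_real x - (\<Sum>i\<in>UNIV. p i * (model_decrease x i - \<gamma> i * \<nu> i * residual x i / 2))"
    by (simp add: F_real_def sum_subtractf)
  finally show ?thesis .
qed

lemma block_distance_decrease:
  assumes x_in: "x \<in> H" and z_dom: "z \<in> V i" "h i z < \<infinity>"
  shows "((norm (T x $ i - z))\<^sup>2 - (norm (x $ i - z))\<^sup>2) / (2 * \<gamma> i)
    \<le> h_real i z - h_real i (x $ i) + grad x $ i \<bullet> (z - x $ i)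
      + (model_decrease x i - residual x i / 2)"
proof -
  have "(norm (x $ i - z))\<^sup>2 = (norm (T x $ i - x $ i))\<^sup>2
      + 2 * ((x $ i - T x $ i) \<bullet> (T x $ i - z)) + (norm (T x $ i - z))\<^sup>2"
    by (simp add: power2_norm_eq_inner inner_diff_left inner_diff_right inner_commute)
  then have "((norm (T x $ i - z))\<^sup>2 - (norm (x $ i - z))\<^sup>2) / (2 * \<gamma> i)
      = - ((x $ i - T x $ i) \<bullet> (T x $ i - z) / \<gamma> i) - residual x i / 2"
    using \<gamma>_pos[of i] by (simp add: residual_def field_simps)
  also have "\<dots> \<le> h_real i z - h_real i (T x $ i) + grad x $ i \<bullet> (z - T x $ i) - residual x i / 2"
    using T_variational[OF x_in z_dom] by simp
  also have "\<dots> = h_real i z - h_real i (x $ i) + grad x $ i \<bullet> (z - x $ i)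
      + (model_decrease x i - residual x i / 2)"
    by (simp add: model_decrease_def inner_diff_right)
  finally show ?thesis .
qed

text \<open>The weight \<open>1 / (\<gamma> i * p i)\<close> of the norm cancels the probability \<open>p i\<close> of updating block \<open>i\<close>.\<close>

lemma expectation_distance_step_le_model:
  assumes x_dom: "x \<in> dom_F" and z_dom: "z \<in> dom_F"
  shows "expectation (\<lambda>\<omega>. (norm_W \<gamma> p (block_step x (eps \<omega>) - z))\<^sup>2 / 2)
    \<le> (norm_W \<gamma> p (x - z))\<^sup>2 / 2 - (F_real x - F_real z)
      + (\<Sum>i\<in>UNIV. model_decrease x i - residual x i / 2)"
proof -
  have x_in_H: "x \<in> H" and z_in_H: "z \<in> H"
    using x_dom z_dom by (auto intro: dom_F_in_H)
  define sq where "sq y i = 1 / (\<gamma> i * p i) * (norm (y - z $ i))\<^sup>2 / 2" for y i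
  have norm_eq: "(norm_W \<gamma> p (y - z))\<^sup>2 / 2 = (\<Sum>i\<in>UNIV. sq (y $ i) i)" for y
    by (simp add: norm_W_sq[OF \<gamma>_pos p_pos] sq_def sum_divide_distrib)
  have "expectation (\<lambda>\<omega>. (norm_W \<gamma> p (block_step x (eps \<omega>) - z))\<^sup>2 / 2)
      = expectation (\<lambda>\<omega>. \<Sum>i\<in>UNIV. if eps \<omega> i then sq (T x $ i) i else sq (x $ i) i)"
    unfolding norm_eq block_step_nth by (intro Bochner_Integration.integral_cong sum.cong) auto
  also have "\<dots> = (\<Sum>i\<in>UNIV. sq (x $ i) i + p i * (sq (T x $ i) i - sq (x $ i) i))"
    by (rule expectation_blockwise)
  also have "\<dots> \<le> (\<Sum>i\<in>UNIV. sq (x $ i) i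
      + (h_real i (z $ i) - h_real i (x $ i) + grad x $ i \<bullet> (z $ i - x $ i)
      + (model_decrease x i - residual x i / 2)))"
  proof (intro sum_mono add_left_mono)
    fix i
    have "p i * (sq (T x $ i) i - sq (x $ i) i)
        = ((norm (T x $ i - z $ i))\<^sup>2 - (norm (x $ i - z $ i))\<^sup>2) / (2 * \<gamma> i)"
      using p_pos[of i] \<gamma>_pos[of i] by (simp add: sq_def field_simps)
    also have "\<dots> \<le> h_real i (z $ i) - h_real i (x $ i) + grad x $ i \<bullet> (z $ i - x $ i)
        + (model_decrease x i - residual x i / 2)"
      using z_dom by (intro block_distance_decrease x_in_H) (auto simp: dom_F_iff in_H_nth)
    finally show "p i * (sq (T x $ i) i - sq (x $ i) i) \<le> \<dots>" .
  qed
  also have "\<dots> = (norm_W \<gamma> p (x - z))\<^sup>2 / 2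
      + ((\<Sum>i\<in>UNIV. h_real i (z $ i)) - (\<Sum>i\<in>UNIV. h_real i (x $ i))) + grad x \<bullet> (z - x)
      + (\<Sum>i\<in>UNIV. model_decrease x i - residual x i / 2)"
    by (simp add: norm_eq inner_vec_def sum.distrib sum_subtractf)
  also have "\<dots> \<le> (norm_W \<gamma> p (x - z))\<^sup>2 / 2 - (F_real x - F_real z)
      + (\<Sum>i\<in>UNIV. model_decrease x i - residual x i / 2)"
    using convex_on_gradient_inequality[OF H_subspace H_closed f_convex f_diff[OF x_in_H] x_in_H
        z_in_H]
    by (simp add: F_real_def)
  finally show ?thesis .
qed

lemma p_min_pos: "0 < p_min" and p_min_le: "p_min \<le> p i"
  unfolding p_min_def using p_pos by (auto simp: Min_gr_iff)

lemma \<delta>_less_2: "\<delta> < 2" and \<gamma>_\<nu>_le_\<delta>: "\<gamma> i * \<nu> i \<le> \<delta>"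
  unfolding \<delta>_def using \<gamma>_less \<nu>_pos by (auto simp: Max_less_iff pos_less_divide_eq)

lemma rate_const_ge_1: "rate_const \<ge> 1"
proof -
  have "p_min \<le> p undefined"
    by (rule p_min_le)
  also have "\<dots> \<le> 1"
    by (simp add: p_def)
  finally show ?thesis
    unfolding rate_const_def using p_min_pos by (simp add: field_simps max.coboundedI1)
qed

lemma weighted_model_decrease_nonneg:
  assumes "x \<in> dom_F"
  shows "0 \<le> model_decrease x i - \<gamma> i * \<nu> i * residual x i / 2"
proof -
  have "\<gamma> i * \<nu> i * residual x i \<le> 2 * residual x i"
    using \<gamma>_\<nu>_le_\<delta>[of i] \<delta>_less_2 residual_nonneg by (intro mult_right_mono) auto
  then show ?thesis
    using residual_le_model_decrease[OF assms, of i] by linarith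
qed

lemma model_decrease_le_rate_const_mult:
  assumes x_dom: "x \<in> dom_F"
  shows "model_decrease x i - residual x i / 2
    \<le> rate_const * (p i * (model_decrease x i - \<gamma> i * \<nu> i * residual x i / 2))"
proof -
  define m where "m = max 1 (1 / (2 - \<delta>))"
  define s where "s = model_decrease x i - \<gamma> i * \<nu> i * residual x i / 2"
  have "m > 0" "s \<ge> 0"
    unfolding s_def using weighted_model_decrease_nonneg[OF x_dom] by (auto simp: m_def)
  have "model_decrease x i - residual x i / 2 \<le> m * (model_decrease x i - \<delta> * residual x i / 2)"
    unfolding m_def
    by (intro le_max_inverse_mult residual_nonneg residual_le_model_decrease x_dom \<delta>_less_2)
  also have "\<dots> \<le> m * s"
    unfolding s_def using \<open>m > 0\<close> \<gamma>_\<nu>_le_\<delta>[of i] residual_nonneg[of x i]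
    by (intro mult_left_mono diff_left_mono divide_right_mono mult_right_mono) auto
  also have "\<dots> \<le> m * s * (p i / p_min)"
    using \<open>m > 0\<close> \<open>s \<ge> 0\<close> p_min_pos p_min_le[of i] mult_left_mono[of 1 "p i / p_min" "m * s"]
    by simp
  finally show ?thesis
    by (simp add: rate_const_def m_def s_def mult.commute mult.left_commute)
qed

lemma expectation_F_step_le:
  assumes "x \<in> dom_F"
  shows "expectation (\<lambda>\<omega>. F_real (block_step x (eps \<omega>))) \<le> F_real x"
proof -
  have "0 \<le> (\<Sum>i\<in>UNIV. p i * (model_decrease x i - \<gamma> i * \<nu> i * residual x i / 2))"
    using weighted_model_decrease_nonneg[OF assms] p_pos
    by (intro sum_nonneg mult_nonneg_nonneg) (auto intro: less_imp_le)
  with expectation_F_step_le_model[OF assms] show ?thesis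
    by linarith
qed

definition lyapunov :: "'a ^ 'm \<Rightarrow> 'a ^ 'm \<Rightarrow> real" where
  "lyapunov z x = (norm_W \<gamma> p (x - z))\<^sup>2 / 2 + rate_const * (F_real x - F_real z)"

lemma expectation_lyapunov_step_le:
  assumes x_dom: "x \<in> dom_F" and z_dom: "z \<in> dom_F"
  shows "expectation (\<lambda>\<omega>. lyapunov z (block_step x (eps \<omega>))) \<le> lyapunov z x - (F_real x - F_real z)"
proof -
  have "(\<Sum>i\<in>UNIV. model_decrease x i - residual x i / 2)
      \<le> rate_const * (\<Sum>i\<in>UNIV. p i * (model_decrease x i - \<gamma> i * \<nu> i * residual x i / 2))"
    unfolding sum_distrib_left by (intro sum_mono model_decrease_le_rate_const_mult x_dom)
  also have "\<dots> \<le> rate_const * (F_real x - expectation (\<lambda>\<omega>. F_real (block_step x (eps \<omega>))))"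
    using expectation_F_step_le_model[OF x_dom] rate_const_ge_1 by (intro mult_left_mono) auto
  finally have "(\<Sum>i\<in>UNIV. model_decrease x i - residual x i / 2)
      \<le> rate_const * F_real x - rate_const * expectation (\<lambda>\<omega>. F_real (block_step x (eps \<omega>)))"
    by (simp add: right_diff_distrib)
  moreover have "expectation (\<lambda>\<omega>. lyapunov z (block_step x (eps \<omega>)))
      = expectation (\<lambda>\<omega>. (norm_W \<gamma> p (block_step x (eps \<omega>) - z))\<^sup>2 / 2)
        + rate_const * (expectation (\<lambda>\<omega>. F_real (block_step x (eps \<omega>))) - F_real z)"
  proof -
    have "integrable M (\<lambda>\<omega>. F_real (block_step x (eps \<omega>)))"
      "integrable M (\<lambda>\<omega>. (norm_W \<gamma> p (block_step x (eps \<omega>) - z))\<^sup>2 / 2)"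
      by (rule integrable_eps)+
    then show ?thesis
      unfolding lyapunov_def by (simp add: prob_space)
  qed
  ultimately show ?thesis
    using expectation_distance_step_le_model[OF x_dom z_dom]
    by (simp add: lyapunov_def right_diff_distrib)
qed

lemma argmin_set_F_iff: "s \<in> argmin_set H F \<longleftrightarrow> s \<in> dom_F \<and> (\<forall>y\<in>dom_F. F_real s \<le> F_real y)"
proof -
  obtain y0 where "y0 \<in> dom_F"
    using closed_proper_convex_F by (auto simp: closed_proper_convex_on_def proper_on_def dom_F_def)
  have minimizer: "s \<in> argmin_set H F \<longleftrightarrow> s \<in> H \<and> (\<forall>y\<in>H. F s \<le> F y)"
    by (auto simp: argmin_set_def is_arg_min_def not_less)
  have infinite: "F y = \<infinity>" if "y \<in> H" "y \<notin> dom_F" for y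
    using that by (simp add: dom_F_def)
  show ?thesis
    unfolding minimizer
  proof (intro iffI conjI ballI)
    assume s_min: "s \<in> H \<and> (\<forall>y\<in>H. F s \<le> F y)"
    then have "F s \<le> ereal (F_real y0)"
      using \<open>y0 \<in> dom_F\<close> F_eq_F_real dom_F_in_H by metis
    with s_min show "s \<in> dom_F"
      by (auto simp: dom_F_def)
    then show "F_real s \<le> F_real y" if "y \<in> dom_F" for y
      using s_min that F_eq_F_real[of s] F_eq_F_real[of y] dom_F_in_H[of y] by auto
  next
    assume s_min: "s \<in> dom_F \<and> (\<forall>y\<in>dom_F. F_real s \<le> F_real y)"
    then show "s \<in> H"
      by (simp add: dom_F_in_H)
    show "F s \<le> F y" if "y \<in> H" for y
      using s_min infinite[OF that] by (cases "y \<in> dom_F") (auto simp: F_eq_F_real)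
  qed
qed

lemma weak_limit_in_argmin_set:
  assumes X_dom: "\<And>n. X n \<in> dom_F" and s_min: "s \<in> argmin_set H F"
    and F_tendsto: "(\<lambda>n. F_real (X n)) \<longlonglongrightarrow> F_real s"
    and lim: "weakly_tendsto X l"
  shows "l \<in> argmin_set H F"
proof -
  have "(\<lambda>n. F (X n)) \<longlonglongrightarrow> F s"
    using F_tendsto s_min X_dom by (simp add: F_eq_F_real argmin_set_F_iff)
  then have "l \<in> H" "F l \<le> F s"
    using weak_limit_lsc[OF closed_proper_convex_F dom_F_in_H[OF X_dom] _ lim] by blast+
  with s_min show ?thesis
    by (auto simp: argmin_set_def is_arg_min_def not_less intro: order_trans)
qed

end

section \<open>Convergence of the iterates\<close>

lemma decseq_summable_imp_times_tendsto_0: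
  fixes a :: "nat \<Rightarrow> real"
  assumes dec: "decseq a" and nonneg: "\<And>n. a n \<ge> 0" and summable_a: "summable a"
  shows "(\<lambda>n. real n * a n) \<longlonglongrightarrow> 0"
proof (rule tendsto_sandwich)
  show "\<forall>\<^sub>F n in sequentially. 0 \<le> real n * a n"
    using nonneg by simp
  have "real n * a n \<le> 2 * (\<Sum>k. a (k + n div 2))" for n
  proof -
    have "real n * a n \<le> 2 * (real (n - n div 2) * a n)"
      using nonneg by (subst mult.assoc[symmetric], intro mult_right_mono) linarith+
    also have "real (n - n div 2) * a n = (\<Sum>k<n - n div 2. a n)"
      by simp
    also have "\<dots> \<le> (\<Sum>k<n - n div 2. a (k + n div 2))"
      by (intro sum_mono decseqD[OF dec]) auto
    also have "\<dots> \<le> (\<Sum>k. a (k + n div 2))"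
      using summable_a nonneg by (intro sum_le_suminf) (auto simp: summable_iff_shift)
    finally show ?thesis
      by simp
  qed
  then show "\<forall>\<^sub>F n in sequentially. real n * a n \<le> 2 * (\<Sum>k. a (k + n div 2))"
    by simp
  have "filterlim (\<lambda>n::nat. n div 2) sequentially sequentially"
    by (rule filterlim_at_top_div_const_nat) simp
  from filterlim_compose[OF suminf_exist_split2[OF summable_a] this]
  show "(\<lambda>n. 2 * (\<Sum>k. a (k + n div 2))) \<longlonglongrightarrow> 0"
    by (rule tendsto_mult_right_zero)
qed simp

lemma ereal_expectation_real:
  assumes "integrable M X"
  shows "ereal_expectation M (\<lambda>\<omega>. ereal (X \<omega>)) = ereal (\<integral>\<omega>. X \<omega> \<partial>M)"
proof -
  have "(\<integral>\<^sup>+\<omega>. ennreal (X \<omega>) \<partial>M) \<noteq> \<infinity>" "(\<integral>\<^sup>+\<omega>. ennreal (- X \<omega>) \<partial>M) \<noteq> \<infinity>"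
    using assms by (auto simp: real_integrable_def)
  then show ?thesis
    unfolding ereal_expectation_def real_lebesgue_integral_def[OF assms] uminus_ereal.simps
      e2ennreal_ereal
    by (cases "\<integral>\<^sup>+\<omega>. ennreal (X \<omega>) \<partial>M"; cases "\<integral>\<^sup>+\<omega>. ennreal (- X \<omega>) \<partial>M")
      (auto simp: enn2ereal_ennreal)
qed

lemma ereal_expectation_cong:
  assumes "\<And>\<omega>. \<omega> \<in> space M \<Longrightarrow> X \<omega> = Y \<omega>"
  shows "ereal_expectation M X = ereal_expectation M Y"
  unfolding ereal_expectation_def using assms by (simp cong: nn_integral_cong)

locale random_block_prox_gradient = block_prox_gradient M eps V f h p \<nu> \<gamma>
  for M :: "'w measure" and eps :: "'w \<Rightarrow> 'm::finite \<Rightarrow> bool"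
    and V :: "'m \<Rightarrow> 'a::{real_inner, complete_space, second_countable_topology} set"
    and f h p \<nu> \<gamma> +
  fixes epsn :: "nat \<Rightarrow> 'w \<Rightarrow> 'm \<Rightarrow> bool" and x0 :: "'a ^ 'm" and x :: "nat \<Rightarrow> 'w \<Rightarrow> 'a ^ 'm"
  assumes epsn_indep: "indep_vars (\<lambda>_. count_space UNIV) epsn UNIV"
    and epsn_copies: "\<And>n. distr M (count_space UNIV) (epsn n) = distr M (count_space UNIV) eps"
    and x0_H: "x0 \<in> direct_sum V"
    and x0_dom: "separable_sum h x0 < \<infinity>"
    and iterate_0: "\<And>\<omega>. \<omega> \<in> space M \<Longrightarrow> x 0 \<omega> = x0"
    and iterate_Suc: "\<And>n \<omega> i. \<omega> \<in> space M \<Longrightarrow>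
      x (Suc n) \<omega> $ i = x n \<omega> $ i + of_bool (epsn n \<omega> i) *\<^sub>R
        (prox_on (V i) (\<lambda>z. ereal (\<gamma> i) * h i z)
           (x n \<omega> $ i - \<gamma> i *\<^sub>R (gradient_on (direct_sum V) f (x n \<omega>) $ i)) - x n \<omega> $ i)"

sublocale random_block_prox_gradient \<subseteq> iid_recursion M eps epsn dom_F block_step x0 x
proof
  show "x0 \<in> dom_F"
    using x0_H x0_dom by (simp add: dom_F_def F_def)
  show "x (Suc n) \<omega> = block_step (x n \<omega>) (epsn n \<omega>)" if "\<omega> \<in> space M" for n \<omega>
    using that by (simp add: vec_eq_iff iterate_Suc block_step_def mask_def forward_backward_def)
qed (simp_all add: eps_measurable epsn_indep epsn_copies iterate_0 block_step_in_dom_F)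

context random_block_prox_gradient
begin

definition EF :: "nat \<Rightarrow> real" where
  "EF n = expectation (\<lambda>\<omega>. F_real (x n \<omega>))"

lemma ereal_expectation_F: "ereal_expectation M (\<lambda>\<omega>. F (x n \<omega>)) = ereal (EF n)"
proof -
  have "ereal_expectation M (\<lambda>\<omega>. F (x n \<omega>)) = ereal_expectation M (\<lambda>\<omega>. ereal (F_real (x n \<omega>)))"
    by (rule ereal_expectation_cong) (simp add: F_eq_F_real x_in)
  then show ?thesis
    by (simp add: ereal_expectation_real integrable_x EF_def)
qed

lemma expectation_x_0: "expectation (\<lambda>\<omega>. (g (x 0 \<omega>) :: real)) = g x0"
proof -
  have "expectation (\<lambda>\<omega>. g (x 0 \<omega>)) = expectation (\<lambda>\<omega>. g x0)"
    by (intro Bochner_Integration.integral_cong) (simp_all add: iterate_0)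
  then show ?thesis
    by (simp add: prob_space)
qed

lemma EF_0: "EF 0 = F_real x0"
  unfolding EF_def by (rule expectation_x_0)

lemma EF_decseq: "decseq EF"
  unfolding EF_def by (intro decseq_SucI expectation_Suc_le expectation_F_step_le)

lemma EF_ge:
  assumes "\<And>y. y \<in> dom_F \<Longrightarrow> b \<le> F_real y"
  shows "b \<le> EF n"
proof -
  have "expectation (\<lambda>\<omega>. b) \<le> EF n"
    unfolding EF_def by (intro integral_mono integrable_x assms x_in) auto
  then show ?thesis
    by (simp add: prob_space)
qed

lemma telescoped_estimate:
  assumes z_dom: "z \<in> dom_F"
  shows "(\<Sum>k<n. EF k - F_real z) + rate_const * (EF n - F_real z)
    \<le> (norm_W \<gamma> p (x0 - z))\<^sup>2 / 2 + rate_const * (F_real x0 - F_real z)"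
proof -
  have "(\<Sum>k<n. EF k - F_real z) + expectation (\<lambda>\<omega>. lyapunov z (x n \<omega>)) \<le> lyapunov z x0"
  proof (induction n)
    case 0
    then show ?case
      by (simp add: expectation_x_0)
  next
    case (Suc n)
    have "expectation (\<lambda>\<omega>. lyapunov z (x (Suc n) \<omega>))
        \<le> expectation (\<lambda>\<omega>. lyapunov z (x n \<omega>) - (F_real (x n \<omega>) - F_real z))"
      by (intro expectation_Suc_le expectation_lyapunov_step_le z_dom)
    also have "\<dots> = expectation (\<lambda>\<omega>. lyapunov z (x n \<omega>)) - (EF n - F_real z)"
      using integrable_x[of "lyapunov z" n] integrable_x[of F_real n]
      by (simp add: EF_def prob_space)
    finally show ?case
      using Suc by simp
  qed
  moreover have "rate_const * (EF n - F_real z) \<le> expectation (\<lambda>\<omega>. lyapunov z (x n \<omega>))"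
  proof -
    have "rate_const * (EF n - F_real z)
        = expectation (\<lambda>\<omega>. rate_const * (F_real (x n \<omega>) - F_real z))"
      using integrable_x[of F_real n] by (simp add: EF_def prob_space)
    also have "\<dots> \<le> expectation (\<lambda>\<omega>. lyapunov z (x n \<omega>))"
      using integrable_x[of "\<lambda>y. rate_const * (F_real y - F_real z)" n]
        integrable_x[of "lyapunov z" n]
      by (intro integral_mono) (auto simp: lyapunov_def)
    finally show ?thesis .
  qed
  ultimately show ?thesis
    by (simp add: lyapunov_def)
qed

lemma EF_less_F_real_add:
  assumes z_dom: "z \<in> dom_F" and e_pos: "e > 0"
  obtains n where "EF n < F_real z + e"
proof -
  define R where "R = (norm_W \<gamma> p (x0 - z))\<^sup>2 / 2 + rate_const * (F_real x0 - F_real z)"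
  obtain n where n_large: "R < real n * e"
    using e_pos reals_Archimedean3 by blast
  have "EF n < F_real z + e"
  proof (rule ccontr)
    assume "\<not> ?thesis"
    then have e_le: "e \<le> EF n - F_real z"
      by simp
    have "real n * e = (\<Sum>k<n. e)"
      by simp
    also have "\<dots> \<le> (\<Sum>k<n. EF k - F_real z)"
    proof (rule sum_mono)
      fix k assume "k \<in> {..<n}"
      then show "e \<le> EF k - F_real z"
        using e_le decseqD[OF EF_decseq, of k n] by simp
    qed
    also have "\<dots> \<le> (\<Sum>k<n. EF k - F_real z) + rate_const * (EF n - F_real z)"
      using e_le e_pos rate_const_ge_1 by simp
    also have "\<dots> \<le> R"
      unfolding R_def by (rule telescoped_estimate[OF z_dom])
    finally show False
      using n_large by simp
  qed
  then show thesis
    by (rule that)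
qed

theorem expected_objective_tendsto_Inf:
  "(\<lambda>n. ereal_expectation M (\<lambda>\<omega>. F (x n \<omega>))) \<longlonglongrightarrow> (INF y\<in>H. F y)"
proof -
  have "(\<lambda>n. ereal (EF n)) \<longlonglongrightarrow> (INF n. ereal (EF n))"
    using EF_decseq by (intro LIMSEQ_INF) (auto simp: decseq_def)
  also have "(INF n. ereal (EF n)) = (INF y\<in>H. F y)"
  proof (intro antisym INF_greatest)
    fix y assume "y \<in> H"
    show "(INF n. ereal (EF n)) \<le> F y"
    proof (cases "y \<in> dom_F")
      case True
      show ?thesis
        unfolding F_eq_F_real[OF True]
      proof (rule ereal_le_epsilon2)
        fix e :: real assume "e > 0"
        then obtain n where "EF n < F_real y + e"
          using EF_less_F_real_add[OF True] by blast
        then show "(INF n. ereal (EF n)) \<le> ereal (F_real y) + ereal e"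
          by (intro INF_lower2[of n]) auto
      qed
    qed (use \<open>y \<in> H\<close> in \<open>simp add: dom_F_def\<close>)
  next
    fix n
    have Inf_le: "(INF y\<in>H. F y) \<le> ereal (F_real y)" if "y \<in> dom_F" for y
      unfolding F_eq_F_real[OF that, symmetric] using dom_F_in_H[OF that] by (rule INF_lower)
    show "(INF y\<in>H. F y) \<le> ereal (EF n)"
    proof (cases "INF y\<in>H. F y")
      case (real b)
      then show ?thesis
        using EF_ge[of b n] Inf_le by simp
    next
      case PInf
      then show ?thesis
        using Inf_le[OF x0_in] by simp
    qed simp
  qed
  finally show ?thesis
    by (simp only: ereal_expectation_F)
qed

context
  fixes s assumes s: "s \<in> argmin_set H F"
begin

lemma s_in_dom_F: "s \<in> dom_F" and F_real_ge: "y \<in> dom_F \<Longrightarrow> F_real s \<le> F_real y"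
  using s by (auto simp: argmin_set_F_iff)

lemma Inf_F_eq: "(INF y\<in>H. F y) = ereal (F_real s)"
proof -
  have "s \<in> H" "\<And>y. y \<in> H \<Longrightarrow> F s \<le> F y"
    using s by (auto simp: argmin_set_def is_arg_min_def not_less)
  then have "(INF y\<in>H. F y) = F s"
    by (intro antisym INF_lower INF_greatest)
  then show ?thesis
    by (simp add: F_eq_F_real s_in_dom_F)
qed

lemma expected_gap_eq:
  "ereal_expectation M (\<lambda>\<omega>. F (x n \<omega>)) - (INF y\<in>H. F y) = ereal (EF n - F_real s)"
  by (simp add: ereal_expectation_F Inf_F_eq)

lemma EF_ge_min: "F_real s \<le> EF n"
  by (rule EF_ge) (rule F_real_ge)

lemma summable_EF_gap: "summable (\<lambda>n. EF n - F_real s)"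
proof (rule summableI_nonneg_bounded)
  show "0 \<le> EF n - F_real s" for n
    using EF_ge_min by simp
  show "(\<Sum>k<n. EF k - F_real s)
      \<le> (norm_W \<gamma> p (x0 - s))\<^sup>2 / 2 + rate_const * (F_real x0 - F_real s)" for n
  proof -
    have "0 \<le> rate_const * (EF n - F_real s)"
      using EF_ge_min rate_const_ge_1 by simp
    then show ?thesis
      using telescoped_estimate[OF s_in_dom_F, of n] by linarith
  qed
qed

lemma times_EF_gap_tendsto_0: "(\<lambda>n. real n * (EF n - F_real s)) \<longlonglongrightarrow> 0"
  using EF_decseq EF_ge_min summable_EF_gap
  by (intro decseq_summable_imp_times_tendsto_0) (auto simp: decseq_def)

lemma times_EF_gap_le:
  assumes "n \<ge> 1"
  shows "real n * (EF n - F_real s)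
    \<le> (norm_W \<gamma> p (x0 - s))\<^sup>2 / 2 + (rate_const - 1) * (F_real x0 - F_real s)"
proof -
  obtain m where n_eq: "n = Suc m"
    using assms by (cases n) auto
  have "real m * (EF n - F_real s) = (\<Sum>k<m. EF n - F_real s)"
    by simp
  also have "\<dots> \<le> (\<Sum>k<m. EF (Suc k) - F_real s)"
    using n_eq by (intro sum_mono diff_right_mono decseqD[OF EF_decseq]) auto
  also have "\<dots> = (\<Sum>k<n. EF k - F_real s) - (F_real x0 - F_real s)"
    unfolding n_eq sum.lessThan_Suc_shift by (simp add: EF_0)
  finally have "real n * (EF n - F_real s) + (rate_const - 1) * (EF n - F_real s)
      \<le> (norm_W \<gamma> p (x0 - s))\<^sup>2 / 2 + (rate_const - 1) * (F_real x0 - F_real s)"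
    using telescoped_estimate[OF s_in_dom_F, of n] n_eq by (simp add: algebra_simps)
  moreover have "(rate_const - 1) * (EF n - F_real s) \<ge> 0"
    using rate_const_ge_1 EF_ge_min by simp
  ultimately show ?thesis
    by linarith
qed

lemma AE_F_real_tendsto: "AE \<omega> in M. (\<lambda>n. F_real (x n \<omega>)) \<longlonglongrightarrow> F_real s"
proof -
  have "expectation (\<lambda>\<omega>. F_real (x n \<omega>) - F_real s) = EF n - F_real s" for n
    unfolding EF_def using integrable_x[of F_real n] by (simp add: prob_space)
  then have "summable (\<lambda>n. expectation (\<lambda>\<omega>. F_real (x n \<omega>) - F_real s))"
    using summable_EF_gap by simp
  then have "AE \<omega> in M. (\<lambda>n. F_real (x n \<omega>) - F_real s) \<longlonglongrightarrow> 0"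
    using F_real_ge[OF x_in] integrable_x[of "\<lambda>y. F_real y - F_real s"]
    by (intro AE_tendsto_0_if_summable_expectation) auto
  then show ?thesis
    by eventually_elim (simp add: LIM_zero_iff)
qed

lemma lyapunov_nonneg: "y \<in> dom_F \<Longrightarrow> 0 \<le> lyapunov s y"
  using F_real_ge rate_const_ge_1 by (simp add: lyapunov_def)

lemma AE_convergent_norm_W: "AE \<omega> in M. convergent (\<lambda>n. norm_W \<gamma> p (x n \<omega> - s))"
proof -
  have "expectation (\<lambda>\<omega>. lyapunov s (block_step y (eps \<omega>))) \<le> lyapunov s y" if "y \<in> dom_F" for y
    using expectation_lyapunov_step_le[OF that s_in_dom_F] F_real_ge[OF that] by linarith
  then have "AE \<omega> in M. convergent (\<lambda>n. lyapunov s (x n \<omega>))"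
    by (intro AE_convergent_lyapunov lyapunov_nonneg)
  with AE_F_real_tendsto show ?thesis
  proof eventually_elim
    case (elim \<omega>)
    then obtain l where "(\<lambda>n. lyapunov s (x n \<omega>)) \<longlonglongrightarrow> l"
      by (auto simp: convergent_def)
    then have "(\<lambda>n. sqrt (2 * (lyapunov s (x n \<omega>) - rate_const * (F_real (x n \<omega>) - F_real s))))
        \<longlonglongrightarrow> sqrt (2 * (l - rate_const * (F_real s - F_real s)))"
      using elim(1) by (intro tendsto_intros)
    moreover have "sqrt (2 * (lyapunov s y - rate_const * (F_real y - F_real s)))
        = norm_W \<gamma> p (y - s)" for y
      by (simp add: lyapunov_def norm_W_eq_norm_rescale[OF \<gamma>_pos p_pos])
    ultimately show ?case
      by (auto simp: convergent_def)
  qed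
qed

end

theorem expected_gap_smallo:
  assumes "argmin_set H F \<noteq> {}"
  shows "(\<lambda>n. real_of_ereal (ereal_expectation M (\<lambda>\<omega>. F (x n \<omega>)) - (INF y\<in>H. F y)))
    \<in> o(\<lambda>n. 1 / real n)"
proof (rule smalloI_tendsto)
  obtain s where s_min: "s \<in> argmin_set H F"
    using assms by blast
  then show "(\<lambda>n. real_of_ereal (ereal_expectation M (\<lambda>\<omega>. F (x n \<omega>)) - (INF y\<in>H. F y))
      / (1 / real n)) \<longlonglongrightarrow> 0"
    using times_EF_gap_tendsto_0[OF s_min] by (simp add: expected_gap_eq[OF s_min] mult.commute)
  show "\<forall>\<^sub>F n in sequentially. 1 / real n \<noteq> 0"
    using eventually_gt_at_top[of 0] by eventually_elim simp
qed

theorem expected_gap_le: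
  assumes nonempty: "argmin_set H F \<noteq> {}" and n_ge_1: "n \<ge> 1"
  shows "ereal_expectation M (\<lambda>\<omega>. F (x n \<omega>)) - (INF y\<in>H. F y)
    \<le> (ereal ((dist_W \<gamma> p x0 (argmin_set H F))\<^sup>2 / 2)
        + ereal (rate_const - 1) * (F x0 - (INF y\<in>H. F y))) * ereal (1 / real n)"
proof -
  obtain s where s_min: "s \<in> argmin_set H F"
    using nonempty by blast
  define K where "K = 2 * (real n * (EF n - F_real s) - (rate_const - 1) * (F_real x0 - F_real s))"
  have "K \<le> (norm_W \<gamma> p (x0 - z))\<^sup>2" if "z \<in> argmin_set H F" for z
  proof -
    have "F_real z = F_real s"
      using Inf_F_eq[OF that] Inf_F_eq[OF s_min] by simp
    then show ?thesis
      using times_EF_gap_le[OF that n_ge_1] by (simp add: K_def)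
  qed
  then have "K \<le> (dist_W \<gamma> p x0 (argmin_set H F))\<^sup>2"
    by (rule le_dist_W_sq[OF nonempty _ \<gamma>_pos p_pos])
  then have "EF n - F_real s
      \<le> ((dist_W \<gamma> p x0 (argmin_set H F))\<^sup>2 / 2
        + (rate_const - 1) * (F_real x0 - F_real s)) * (1 / real n)"
    using n_ge_1 by (simp add: K_def pos_le_divide_eq mult.commute)
  then show ?thesis
    unfolding expected_gap_eq[OF s_min] by (simp add: Inf_F_eq[OF s_min] F_eq_F_real[OF x0_in])
qed

lemma AE_weakly_convergent:
  assumes "argmin_set H F \<noteq> {}"
  shows "AE \<omega> in M. \<exists>l\<in>argmin_set H F. weakly_tendsto (\<lambda>n. x n \<omega>) l"
proof (rule AE_opial_norm_W[OF \<gamma>_pos p_pos assms AE_convergent_norm_W])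
  obtain s where s_min: "s \<in> argmin_set H F"
    using assms by blast
  show "AE \<omega> in M. \<forall>r l. strict_mono r \<longrightarrow> weakly_tendsto ((\<lambda>n. x n \<omega>) \<circ> r) l \<longrightarrow> l \<in> argmin_set H F"
    using AE_F_real_tendsto[OF s_min] AE_space
  proof eventually_elim
    case (elim \<omega>)
    show ?case
    proof (intro allI impI)
      fix r :: "nat \<Rightarrow> nat" and l assume subseq: "strict_mono r" "weakly_tendsto ((\<lambda>n. x n \<omega>) \<circ> r) l"
      show "l \<in> argmin_set H F"
        using LIMSEQ_subseq_LIMSEQ[OF elim(1) subseq(1)] x_in[OF elim(2)]
        by (intro weak_limit_in_argmin_set[OF _ s_min _ subseq(2)]) (simp_all add: o_def)
    qed
  qed
qed

theorem weakly_convergent_to_random_minimizer: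
  assumes "argmin_set H F \<noteq> {}"
  shows "\<exists>xs. xs \<in> borel_measurable M \<and> (\<forall>\<omega>\<in>space M. xs \<omega> \<in> argmin_set H F) \<and>
    (AE \<omega> in M. weakly_tendsto_on H (\<lambda>n. x n \<omega>) (xs \<omega>))"
proof -
  obtain s where s_min: "s \<in> argmin_set H F"
    using assms by blast
  obtain xs where "xs \<in> borel_measurable M" "xs \<in> space M \<rightarrow> argmin_set H F"
    and weak: "AE \<omega> in M. weakly_tendsto (\<lambda>n. x n \<omega>) (xs \<omega>)"
    by (rule measurable_weak_limit[OF borel_measurable_x s_min AE_weakly_convergent[OF assms]])
  moreover have "AE \<omega> in M. weakly_tendsto_on H (\<lambda>n. x n \<omega>) (xs \<omega>)"
    using weak by eventually_elim (simp add: weakly_tendsto_on_def)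
  ultimately show ?thesis
    by (auto simp: Pi_iff)
qed

end

theorem theorem4p9:
  fixes V :: "'m::finite \<Rightarrow> 'a::{real_inner, complete_space, second_countable_topology} set"
    and H :: "('a ^ 'm) set"
    and f :: "'a ^ 'm \<Rightarrow> real"
    and h :: "'m \<Rightarrow> 'a \<Rightarrow> ereal"
    and F :: "'a ^ 'm \<Rightarrow> ereal"
    and M :: "'w measure"
    and eps :: "'w \<Rightarrow> 'm \<Rightarrow> bool"
    and epsn :: "nat \<Rightarrow> 'w \<Rightarrow> 'm \<Rightarrow> bool"
    and p \<nu> \<gamma> :: "'m \<Rightarrow> real"
    and x0 :: "'a ^ 'm"
    and x :: "nat \<Rightarrow> 'w \<Rightarrow> 'a ^ 'm"
    and \<delta> p_min :: real
    and F_inf :: ereal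
    and S :: "('a ^ 'm) set"
  assumes V_subspace: "\<And>i. subspace (V i)"
    and V_closed: "\<And>i. closed (V i)"
    and H_def: "H = direct_sum V"
    and f_convex: "convex_on H f"
    and f_diff: "\<And>y. y \<in> H \<Longrightarrow> f differentiable (at y within H)"
    and h_proper: "\<And>i. proper_on (V i) (h i)"
    and h_convex: "\<And>i. ereal_convex_on (V i) (h i)"
    and h_lsc: "\<And>i. lsc_on (V i) (h i)"
    and F_def: "\<And>y. F y = ereal (f y) + separable_sum h y"
    and M_prob: "prob_space M"
    and eps_measurable: "eps \<in> measurable M (count_space UNIV)"
    and p_def: "\<And>i. p i = measure M {\<omega> \<in> space M. eps \<omega> i}"
    and p_pos: "\<And>i. p i > 0"
    and eps_nonzero: "measure M {\<omega> \<in> space M. \<forall>i. \<not> eps \<omega> i} = 0"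
    and epsn_indep: "prob_space.indep_vars M (\<lambda>_. count_space UNIV) epsn UNIV"
    and epsn_copies: "\<And>n. distr M (count_space UNIV) (epsn n) = distr M (count_space UNIV) eps"
    and \<nu>_pos: "\<And>i. \<nu> i > 0"
    and smooth: "\<And>y v. y \<in> H \<Longrightarrow> v \<in> H \<Longrightarrow>
      (\<integral>\<omega>. f (y + eps \<omega> \<odot> v) \<partial>M)
        \<le> f y + (\<integral>\<omega>. gradient_on H f y \<bullet> (eps \<omega> \<odot> v) \<partial>M)
          + 1 / 2 * (\<Sum>i\<in>UNIV. p i * \<nu> i * (norm (v $ i))\<^sup>2)"
    and \<gamma>_pos: "\<And>i. 0 < \<gamma> i"
    and \<gamma>_less: "\<And>i. \<gamma> i < 2 / \<nu> i"
    and x0_H: "x0 \<in> H"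
    and x0_dom: "separable_sum h x0 < \<infinity>"
    and x_0: "\<And>\<omega>. \<omega> \<in> space M \<Longrightarrow> x 0 \<omega> = x0"
    and x_Suc: "\<And>n \<omega> i. \<omega> \<in> space M \<Longrightarrow>
      x (Suc n) \<omega> $ i = x n \<omega> $ i + of_bool (epsn n \<omega> i) *\<^sub>R
        (prox_on (V i) (\<lambda>z. ereal (\<gamma> i) * h i z)
           (x n \<omega> $ i - \<gamma> i *\<^sub>R (gradient_on H f (x n \<omega>) $ i)) - x n \<omega> $ i)"
    and \<delta>_def: "\<delta> = Max (range (\<lambda>i. \<gamma> i * \<nu> i))"
    and p_min_def: "p_min = Min (range p)"
    and F_inf_def: "F_inf = (INF y\<in>H. F y)"
    and S_def: "S = argmin_set H F"
  shows "((\<lambda>n. ereal_expectation M (\<lambda>\<omega>. F (x n \<omega>))) \<longlonglongrightarrow> F_inf) \<and>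
    (S \<noteq> {} \<longrightarrow>
      (\<lambda>n. real_of_ereal (ereal_expectation M (\<lambda>\<omega>. F (x n \<omega>)) - F_inf)) \<in> o(\<lambda>n. 1 / real n) \<and>
      (\<forall>n\<ge>1. ereal_expectation M (\<lambda>\<omega>. F (x n \<omega>)) - F_inf
        \<le> (ereal ((dist_W \<gamma> p x0 S)\<^sup>2 / 2)
            + ereal (max 1 (1 / (2 - \<delta>)) / p_min - 1) * (F x0 - F_inf)) * ereal (1 / real n)) \<and>
      (\<exists>xs. xs \<in> borel_measurable M \<and> (\<forall>\<omega>\<in>space M. xs \<omega> \<in> S) \<and>
        (AE \<omega> in M. weakly_tendsto_on H (\<lambda>n. x n \<omega>) (xs \<omega>))))"
proof -
  interpret prob_space M by fact
  interpret R: random_block_prox_gradient M eps V f h p \<nu> \<gamma> epsn x0 x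
    using assms by unfold_locales (simp_all only: H_def)
  have F: "F = R.F"
    by (simp add: fun_eq_iff F_def R.F_def)
  have rate: "max 1 (1 / (2 - \<delta>)) / p_min = R.rate_const"
    by (simp add: R.rate_const_def R.\<delta>_def R.p_min_def \<delta>_def p_min_def)
  show ?thesis
    unfolding F_inf_def S_def H_def F rate
    by (intro conjI impI allI R.expected_objective_tendsto_Inf R.expected_gap_smallo
        R.expected_gap_le R.weakly_convergent_to_random_minimizer)
qed

end
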